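(* Let $L$ be an $n$-dimensional nilpotent Lie algebra of class two such that $\dim(L/Z(L))=d$ and $\dim L^2=\frac{1}{2}d(d-1)-1$ or $\dim L^2=\frac{1}{2}d(d-1)-2$. Then $L$ is capable.
   Context: Lie algebras are over a field, and $L^2=[L,L]$. "Class two" means nilpotent of class exactly two. A Lie algebra $L$ is called capable if $L\cong E/Z(E)$ for some Lie algebra $E$. *)

theory Defs
  imports Complex_Main "HOL-Algebra.QuotRing" "Jordan_Normal_Form.Missing_VectorSpace"
begin

text \<open>
  A Lie algebra over the field \<open>K\<close> is a vector space record whose multiplication \<open>\<otimes>\<close> is the
  Lie bracket, so that \<open>x \<otimes>\<^bsub>L\<^esub> y\<close> stands for \<open>[x, y]\<close>. The field \<open>one\<close> of the record is
  not used. No restriction is placed on the characteristic, hence \<open>[x, x] = 0\<close> rather than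
  antisymmetry.
\<close>

locale lie_algebra = vectorspace K L for K and L (structure) +
  assumes bracket_closed: "\<lbrakk>x \<in> carrier L; y \<in> carrier L\<rbrakk> \<Longrightarrow> x \<otimes> y \<in> carrier L"
    and bracket_add_left: "\<lbrakk>x \<in> carrier L; y \<in> carrier L; z \<in> carrier L\<rbrakk> \<Longrightarrow>
      (x \<oplus> y) \<otimes> z = (x \<otimes> z) \<oplus> (y \<otimes> z)"
    and bracket_add_right: "\<lbrakk>x \<in> carrier L; y \<in> carrier L; z \<in> carrier L\<rbrakk> \<Longrightarrow>
      x \<otimes> (y \<oplus> z) = (x \<otimes> y) \<oplus> (x \<otimes> z)"
    and bracket_smult_left: "\<lbrakk>a \<in> carrier K; x \<in> carrier L; y \<in> carrier L\<rbrakk> \<Longrightarrow>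
      (a \<odot> x) \<otimes> y = a \<odot> (x \<otimes> y)"
    and bracket_smult_right: "\<lbrakk>a \<in> carrier K; x \<in> carrier L; y \<in> carrier L\<rbrakk> \<Longrightarrow>
      x \<otimes> (a \<odot> y) = a \<odot> (x \<otimes> y)"
    and bracket_self: "x \<in> carrier L \<Longrightarrow> x \<otimes> x = \<zero>"
    and jacobi: "\<lbrakk>x \<in> carrier L; y \<in> carrier L; z \<in> carrier L\<rbrakk> \<Longrightarrow>
      (x \<otimes> (y \<otimes> z)) \<oplus> (y \<otimes> (z \<otimes> x)) \<oplus> (z \<otimes> (x \<otimes> y)) = \<zero>"

definition lie_center :: "('k, 'a, 'm) module_scheme \<Rightarrow> 'a set" where
  "lie_center L = {z \<in> carrier L. \<forall>x \<in> carrier L. z \<otimes>\<^bsub>L\<^esub> x = \<zero>\<^bsub>L\<^esub>}"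

definition lie_bracket_set ::
  "('k, 'r) ring_scheme \<Rightarrow> ('k, 'a, 'm) module_scheme \<Rightarrow> 'a set \<Rightarrow> 'a set \<Rightarrow> 'a set" where
  "lie_bracket_set K L A B = module.span K L {x \<otimes>\<^bsub>L\<^esub> y | x y. x \<in> A \<and> y \<in> B}"

definition lie_derived :: "('k, 'r) ring_scheme \<Rightarrow> ('k, 'a, 'm) module_scheme \<Rightarrow> 'a set" where
  "lie_derived K L = lie_bracket_set K L (carrier L) (carrier L)"

text \<open>The indexing starts at \<open>0\<close>: \<open>lie_lower_central K L i\<close> is the term usually written
  \<open>L\<^sup>i\<^sup>+\<^sup>1\<close>.\<close>

primrec lie_lower_central ::
  "('k, 'r) ring_scheme \<Rightarrow> ('k, 'a, 'm) module_scheme \<Rightarrow> nat \<Rightarrow> 'a set" where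
  "lie_lower_central K L 0 = carrier L"
| "lie_lower_central K L (Suc i) = lie_bracket_set K L (lie_lower_central K L i) (carrier L)"

definition lie_nilpotent_of_class ::
  "('k, 'r) ring_scheme \<Rightarrow> ('k, 'a, 'm) module_scheme \<Rightarrow> nat \<Rightarrow> bool" where
  "lie_nilpotent_of_class K L c \<longleftrightarrow>
     lie_lower_central K L c = {\<zero>\<^bsub>L\<^esub>} \<and> (\<forall>i<c. lie_lower_central K L i \<noteq> {\<zero>\<^bsub>L\<^esub>})"

text \<open>Cosets as in \<^const>\<open>FactRing\<close>, with the induced scalar multiplication; to be used for an
  ideal \<open>I\<close> of \<open>L\<close>.\<close>

definition lie_quotient ::
  "('k, 'a, 'm) module_scheme \<Rightarrow> 'a set \<Rightarrow> ('k, 'a set) module" where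
  "lie_quotient L I =
     \<lparr>carrier = a_rcosets\<^bsub>L\<^esub> I, mult = rcoset_mult L I, one = I +>\<^bsub>L\<^esub> \<one>\<^bsub>L\<^esub>,
      zero = I, add = set_add L, smult = (\<lambda>a X. \<Union>x\<in>X. I +>\<^bsub>L\<^esub> (a \<odot>\<^bsub>L\<^esub> x))\<rparr>"

definition lie_isomorphic ::
  "('k, 'r) ring_scheme \<Rightarrow> ('k, 'a, 'm) module_scheme \<Rightarrow> ('k, 'b, 'n) module_scheme \<Rightarrow> bool" where
  "lie_isomorphic K L M \<longleftrightarrow>
     (\<exists>f \<in> module_hom K L M. bij_betw f (carrier L) (carrier M) \<and>
        (\<forall>x \<in> carrier L. \<forall>y \<in> carrier L. f (x \<otimes>\<^bsub>L\<^esub> y) = f x \<otimes>\<^bsub>M\<^esub> f y))"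

text \<open>
  HOL cannot quantify existentially over the type of the elements of \<open>E\<close>, so these are taken
  from \<open>'a list\<close>. This is no loss of generality: if \<open>L \<cong> E/Z(E)\<close> with \<open>E\<close> over any type, let
  \<open>E'\<close> be the subalgebra generated by one preimage in \<open>E\<close> of each nonzero element of \<open>L\<close>. Then
  \<open>E = E' + Z(E)\<close>, so \<open>Z(E') = E' \<inter> Z(E)\<close> and \<open>E'/Z(E') \<cong> L\<close>. If \<open>L = 0\<close> then \<open>E' = 0\<close>;
  otherwise \<open>K\<close> embeds into \<open>L\<close>, and \<open>E'\<close>, being spanned by iterated brackets of the
  generators, has at most \<open>max(|L|, \<aleph>\<^sub>0)\<close> elements. In both cases \<open>E'\<close> has a copy inside
  \<open>'a list\<close>.
\<close>

definition lie_capable :: "('k, 'r) ring_scheme \<Rightarrow> ('k, 'a, 'm) module_scheme \<Rightarrow> bool" where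
  "lie_capable K L \<longleftrightarrow>
     (\<exists>E :: ('k, 'a list) module.
        lie_algebra K E \<and> lie_isomorphic K L (lie_quotient E (lie_center E)))"

end

theory Submission
  imports Defs
begin

text \<open>
  Write \<open>Z\<close> for the center of \<open>L\<close>. A bilinear alternating map \<open>b\<close> on \<open>L\<close> with values in a vector
  space \<open>W\<close> that satisfies the cocycle identity \<open>b x [y, z] + b y [z, x] + b z [x, y] = 0\<close> turns
  \<open>L \<oplus> W\<close> into a Lie algebra \<open>E\<close> with bracket \<open>([x, y], b x y)\<close>. If no nonzero \<open>z \<in> Z\<close> satisfies
  \<open>b z x = 0\<close> for all \<open>x\<close>, then the center of \<open>E\<close> is exactly \<open>W\<close>, and \<open>L \<cong> E/Z(E)\<close> is capable
  (\<open>capable_if_faithful\<close>). So it is enough to find such a faithful cocycle.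

  Let \<open>e\<^sub>0, \<dots>, e\<^sub>m\<^sub>-\<^sub>1\<close> be a basis of \<open>L\<close> modulo \<open>Z\<close>, with coordinate forms \<open>\<phi>\<^sub>i\<close> that vanish on \<open>Z\<close>.
  The natural candidate is the map \<open>x, y \<mapsto> (\<phi>\<^sub>i(x) y - \<phi>\<^sub>i(y) x)\<^sub>i\<close> into \<open>L\<^sup>m\<close>, which stands for the map
  \<open>x \<otimes> y - y \<otimes> x\<close> into \<open>L/Z \<otimes> L\<close>. It violates the cocycle identity only by elements of the
  subspace \<open>N\<close> of all vectors whose \<open>i\<close>-th entry is \<open>\<Sum>\<^sub>j\<^sub>>\<^sub>k T\<^sub>i\<^sub>j\<^sub>k [e\<^sub>j, e\<^sub>k]\<close> for some alternating
  3-tensor \<open>T\<close> (\<open>wedge_jacobi\<close>). Every subspace is the kernel of a linear map, so composing with a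
  linear map \<open>P\<close> on \<open>L\<^sup>m\<close> that has kernel \<open>N\<close> gives a cocycle (\<open>projected_wedge_cocycle\<close>).

  Suppose that this cocycle is not faithful: some nonzero \<open>z \<in> Z\<close> pairs to \<open>0\<close> with every \<open>e\<^sub>a\<close>.
  Then, up to sign, for each \<open>a\<close> the vector with \<open>z\<close> in position \<open>a\<close> and \<open>0\<close> elsewhere lies in \<open>N\<close>.
  Thus there are alternating tensors \<open>T\<^sup>a\<close> whose slices \<open>T\<^sup>a\<^sub>i\<close> with \<open>i \<noteq> a\<close> are linear relations
  between the brackets \<open>[e\<^sub>j, e\<^sub>k]\<close>, while the slice \<open>T\<^sup>a\<^sub>a\<close> evaluates to \<open>z \<noteq> 0\<close>. The brackets span
  \<open>L\<^sup>2\<close>, so the assumption on \<open>dim L\<^sup>2\<close> says that at most two relations are independent. Choose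
  \<open>j, k\<close> with \<open>T\<^sup>a\<^sub>a\<^sub>j\<^sub>k \<noteq> 0\<close>. The slices \<open>T\<^sup>a\<^sub>j\<close> and \<open>T\<^sup>a\<^sub>k\<close> are two independent relations, with pivots at
  the pairs \<open>(a, k)\<close> and \<open>(a, j)\<close>, so a relation that vanishes at these two pairs is \<open>0\<close>
  (\<open>relation_vanishes\<close>). By alternation this kills first the slice \<open>T\<^sup>j\<^sub>a\<close>, then all slices \<open>T\<^sup>j\<^sub>b\<close>
  with \<open>b \<noteq> j\<close>, and then \<open>T\<^sup>j\<^sub>j\<close>, which contradicts \<open>z \<noteq> 0\<close> (\<open>no_concentrated_tensors\<close>).
\<close>

section \<open>Complements, projections and linear forms\<close>

lemma (in vectorspace) submodule_neg:
  assumes "submodule K N V" "x \<in> N"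
  shows "\<ominus>\<^bsub>V\<^esub> x \<in> N"
  using assms submodule.smult_closed[OF assms(1), of "\<ominus>\<^bsub>K\<^esub> \<one>\<^bsub>K\<^esub>" x] submodule.subset[OF assms(1)]
  by (auto simp: smult_minus_1)

lemma (in vectorspace) submodule_minus:
  assumes "submodule K N V" "x \<in> N" "y \<in> N"
  shows "x \<ominus>\<^bsub>V\<^esub> y \<in> N"
  using assms by (simp add: a_minus_def submodule_neg submodule.m_closed)

lemma (in vectorspace) submodule_smult_cancel:
  assumes N: "submodule K N V" and "a \<in> carrier K" "a \<noteq> \<zero>\<^bsub>K\<^esub>" "x \<in> carrier V"
    and "a \<odot>\<^bsub>V\<^esub> x \<in> N"
  shows "x \<in> N"
proof -
  have "inv\<^bsub>K\<^esub> a \<odot>\<^bsub>V\<^esub> (a \<odot>\<^bsub>V\<^esub> x) = (inv\<^bsub>K\<^esub> a \<otimes>\<^bsub>K\<^esub> a) \<odot>\<^bsub>V\<^esub> x"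
    using assms by (simp add: smult_assoc1)
  also have "\<dots> = x"
    using assms field_Units by (simp add: Units_l_inv)
  finally show ?thesis
    using submodule.smult_closed[OF N, of "inv\<^bsub>K\<^esub> a" "a \<odot>\<^bsub>V\<^esub> x"] assms by simp
qed

lemma (in vectorspace) submodule_finsum:
  assumes N: "submodule K N V" and "\<And>i. i \<in> A \<Longrightarrow> f i \<in> N"
  shows "(\<Oplus>\<^bsub>V\<^esub>i\<in>A. f i) \<in> N"
proof (cases "finite A")
  case True
  then show ?thesis using assms(2)
  proof (induction A)
    case empty
    then show ?case using submodule.zero_closed[OF N] by simp
  next
    case (insert a A)
    moreover have "f \<in> insert a A \<rightarrow> carrier V"
      using insert.prems submodule.subset[OF N] by blast
    ultimately show ?case
      by (subst finsum_insert) (auto intro: submodule.m_closed[OF N])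
  qed
next
  case False
  then show ?thesis using submodule.zero_closed[OF N] by (simp add: finsum_infinite)
qed

lemma (in vectorspace) neg_zero: "\<ominus>\<^bsub>V\<^esub> \<zero>\<^bsub>V\<^esub> = \<zero>\<^bsub>V\<^esub>"
  using smult_minus_1[OF M.zero_closed] by simp

lemma (in vectorspace) trivial_submodule: "submodule K {\<zero>\<^bsub>V\<^esub>} V"
  by (rule submodule.intro) (auto simp: module_axioms)

lemma (in vectorspace) submodule_sum_is_submodule:
  assumes N: "submodule K N V" and D: "submodule K D V"
  shows "submodule K {x \<oplus>\<^bsub>V\<^esub> y | x y. x \<in> N \<and> y \<in> D} V" (is "submodule K ?S V")
proof (rule submodule.intro)
  note sub = submodule.subset[OF N] submodule.subset[OF D]
  show "module K V" by (rule module_axioms)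
  show "?S \<subseteq> carrier V" using sub by auto
  show "v \<oplus>\<^bsub>V\<^esub> w \<in> ?S" if vw: "v \<in> ?S" "w \<in> ?S" for v w
  proof -
    obtain x y x' y' where *: "x \<in> N" "y \<in> D" "x' \<in> N" "y' \<in> D"
      "v = x \<oplus>\<^bsub>V\<^esub> y" "w = x' \<oplus>\<^bsub>V\<^esub> y'" using vw by auto
    have "v \<oplus>\<^bsub>V\<^esub> w = (x \<oplus>\<^bsub>V\<^esub> x') \<oplus>\<^bsub>V\<^esub> (y \<oplus>\<^bsub>V\<^esub> y')"
      using * sub by (simp add: a_ac subset_iff)
    then show ?thesis
      using * submodule.m_closed[OF N] submodule.m_closed[OF D] by blast
  qed
  show "\<zero>\<^bsub>V\<^esub> \<in> ?S"
    using submodule.zero_closed[OF N] submodule.zero_closed[OF D] by force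
  show "c \<odot>\<^bsub>V\<^esub> v \<in> ?S" if cv: "c \<in> carrier K" "v \<in> ?S" for c v
  proof -
    obtain x y where *: "x \<in> N" "y \<in> D" "v = x \<oplus>\<^bsub>V\<^esub> y" using cv by auto
    then have "c \<odot>\<^bsub>V\<^esub> v = c \<odot>\<^bsub>V\<^esub> x \<oplus>\<^bsub>V\<^esub> c \<odot>\<^bsub>V\<^esub> y"
      using sub cv by (simp add: smult_r_distr subset_iff)
    then show ?thesis
      using * cv submodule.smult_closed[OF N] submodule.smult_closed[OF D] by blast
  qed
qed

lemma (in vectorspace) line_submodule:
  assumes "x \<in> carrier V"
  shows "submodule K {a \<odot>\<^bsub>V\<^esub> x | a. a \<in> carrier K} V" (is "submodule K ?S V")
proof (rule submodule.intro)
  show "v \<oplus>\<^bsub>V\<^esub> w \<in> ?S" if vw: "v \<in> ?S" "w \<in> ?S" for v w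
  proof -
    obtain a b where ab: "a \<in> carrier K" "b \<in> carrier K"
      "v = a \<odot>\<^bsub>V\<^esub> x" "w = b \<odot>\<^bsub>V\<^esub> x"
      using vw by blast
    then have "v \<oplus>\<^bsub>V\<^esub> w = (a \<oplus>\<^bsub>K\<^esub> b) \<odot>\<^bsub>V\<^esub> x"
      using assms by (simp add: smult_l_distr)
    then show ?thesis using ab by blast
  qed
  have "\<zero>\<^bsub>V\<^esub> = \<zero>\<^bsub>K\<^esub> \<odot>\<^bsub>V\<^esub> x" using assms by simp
  then show "\<zero>\<^bsub>V\<^esub> \<in> ?S" by blast
  show "c \<odot>\<^bsub>V\<^esub> v \<in> ?S" if "c \<in> carrier K" "v \<in> ?S" for c v
  proof -
    obtain a where "a \<in> carrier K" "v = a \<odot>\<^bsub>V\<^esub> x" using \<open>v \<in> ?S\<close> by blast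
    then have "c \<odot>\<^bsub>V\<^esub> v = (c \<otimes>\<^bsub>K\<^esub> a) \<odot>\<^bsub>V\<^esub> x" "c \<otimes>\<^bsub>K\<^esub> a \<in> carrier K"
      using assms \<open>c \<in> carrier K\<close> by (simp_all add: smult_assoc1)
    then show ?thesis by blast
  qed
qed (use assms module_axioms in auto)

text \<open>
  Zorn's lemma: take \<open>C\<close> maximal among the subspaces that contain \<open>D\<close> and meet \<open>N\<close> trivially. If
  \<open>x \<notin> N + C\<close>, then \<open>C + Kx\<close> still meets \<open>N\<close> trivially, against maximality.
\<close>

lemma (in vectorspace) complement_containing:
  assumes N: "submodule K N V" and D: "submodule K D V" and ND: "N \<inter> D = {\<zero>\<^bsub>V\<^esub>}"
  obtains C where "submodule K C V" "D \<subseteq> C" "N \<inter> C = {\<zero>\<^bsub>V\<^esub>}"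
    "carrier V = {x \<oplus>\<^bsub>V\<^esub> y | x y. x \<in> N \<and> y \<in> C}"
proof -
  define \<A> where "\<A> = {C. submodule K C V \<and> D \<subseteq> C \<and> N \<inter> C = {\<zero>\<^bsub>V\<^esub>}}"
  have "\<exists>M\<in>\<A>. \<forall>X\<in>\<A>. M \<subseteq> X \<longrightarrow> X = M"
  proof (rule subset_Zorn_nonempty)
    show "\<A> \<noteq> {}" using D ND by (auto simp: \<A>_def)
  next
    fix \<C> assume ne: "\<C> \<noteq> {}" and ch: "subset.chain \<A> \<C>"
    then have sub: "\<C> \<subseteq> \<A>" by (auto simp: subset.chain_def)
    have "submodule K (\<Union>\<C>) V"
    proof (rule nested_union_vs[where I = \<C> and N = "\<lambda>X. X"])
      show "submodule K X V" if "X \<in> \<C>" for X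
        using that sub by (auto simp: \<A>_def)
      show "\<exists>Z. Z \<in> \<C> \<and> X \<subseteq> Z \<and> Y \<subseteq> Z" if "X \<in> \<C>" "Y \<in> \<C>" for X Y
      proof -
        have "X \<subseteq> Y \<or> Y \<subseteq> X" using that ch by (simp add: subset_chain_def)
        then show ?thesis using that by auto
      qed
    qed (use ne in auto)
    then show "\<Union>\<C> \<in> \<A>"
      using sub ne by (auto simp: \<A>_def)
  qed
  then obtain C where "C \<in> \<A>" and max_\<A>: "\<forall>X\<in>\<A>. C \<subseteq> X \<longrightarrow> X = C" ..
  then have C: "submodule K C V" "D \<subseteq> C" "N \<inter> C = {\<zero>\<^bsub>V\<^esub>}" by (simp_all add: \<A>_def)
  have max: "X = C" if "submodule K X V" "D \<subseteq> X" "N \<inter> X = {\<zero>\<^bsub>V\<^esub>}" "C \<subseteq> X" for X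
    using that max_\<A> by (simp add: \<A>_def)
  note sN = submodule.subset[OF N] and sC = submodule.subset[OF C(1)]
  define S where "S = {x \<oplus>\<^bsub>V\<^esub> y | x y. x \<in> N \<and> y \<in> C}"
  have S: "submodule K S V"
    unfolding S_def by (rule submodule_sum_is_submodule[OF N C(1)])
  have CS: "C \<subseteq> S"
  proof
    fix y assume "y \<in> C"
    then have "y = \<zero>\<^bsub>V\<^esub> \<oplus>\<^bsub>V\<^esub> y" using sC by auto
    then show "y \<in> S" using \<open>y \<in> C\<close> submodule.zero_closed[OF N] unfolding S_def by blast
  qed
  have "x \<in> S" if x: "x \<in> carrier V" for x
  proof (rule ccontr)
    assume xS: "x \<notin> S"
    define X where "X = {y \<oplus>\<^bsub>V\<^esub> l | y l. y \<in> C \<and> l \<in> {a \<odot>\<^bsub>V\<^esub> x | a. a \<in> carrier K}}"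
    have X: "submodule K X V"
      unfolding X_def by (rule submodule_sum_is_submodule[OF C(1) line_submodule[OF x]])
    have CX: "C \<subseteq> X"
    proof
      fix y assume "y \<in> C"
      then have "y = y \<oplus>\<^bsub>V\<^esub> \<zero>\<^bsub>K\<^esub> \<odot>\<^bsub>V\<^esub> x" using sC x by auto
      then show "y \<in> X" using \<open>y \<in> C\<close> unfolding X_def by blast
    qed
    have xX: "x \<in> X"
    proof -
      have "x = \<zero>\<^bsub>V\<^esub> \<oplus>\<^bsub>V\<^esub> \<one>\<^bsub>K\<^esub> \<odot>\<^bsub>V\<^esub> x" using x by simp
      then show ?thesis using submodule.zero_closed[OF C(1)] unfolding X_def by blast
    qed
    have "v = \<zero>\<^bsub>V\<^esub>" if v: "v \<in> N" "v \<in> X" for v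
    proof -
      obtain y a where ya: "y \<in> C" "a \<in> carrier K" "v = y \<oplus>\<^bsub>V\<^esub> a \<odot>\<^bsub>V\<^esub> x"
        using v unfolding X_def by auto
      have "a \<odot>\<^bsub>V\<^esub> x = v \<oplus>\<^bsub>V\<^esub> \<ominus>\<^bsub>V\<^esub> y"
        using ya x sC sN v by (simp add: subset_iff a_ac r_neg2)
      then have "a \<odot>\<^bsub>V\<^esub> x \<in> S"
        using v submodule_neg[OF C(1) ya(1)] unfolding S_def by blast
      then have "a = \<zero>\<^bsub>K\<^esub>"
        using submodule_smult_cancel[OF S ya(2) _ x] xS by blast
      then have "v = y" using ya x sC by auto
      then show ?thesis using v ya C(3) by blast
    qed
    then have "N \<inter> X = {\<zero>\<^bsub>V\<^esub>}"
      using submodule.zero_closed[OF N] submodule.zero_closed[OF X] by blast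
    with max[OF X _ _ CX] C(2) CX have "X = C" by blast
    then show False using xX xS CS by blast
  qed
  then have "carrier V = S" using submodule.subset[OF S] by blast
  then show ?thesis using that C unfolding S_def by blast
qed

lemma (in vectorspace) projection_along:
  assumes N: "submodule K N V" and D: "submodule K D V" and ND: "N \<inter> D = {\<zero>\<^bsub>V\<^esub>}"
  shows "\<exists>P \<in> module_hom K V V. (\<forall>x\<in>carrier V. P x \<in> N) \<and> (\<forall>x\<in>N. P x = x) \<and>
    (\<forall>x\<in>D. P x = \<zero>\<^bsub>V\<^esub>)"
proof -
  obtain C where C: "submodule K C V" "D \<subseteq> C" "N \<inter> C = {\<zero>\<^bsub>V\<^esub>}"
    "carrier V = {x \<oplus>\<^bsub>V\<^esub> y | x y. x \<in> N \<and> y \<in> C}"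
    by (rule complement_containing[OF assms])
  note sN = submodule.subset[OF N] and sC = submodule.subset[OF C(1)]
  \<comment> \<open>The \<open>N\<close>-component of a decomposition is unique, so \<open>P\<close> below is well defined.\<close>
  have uniq: "x = x'" if "x \<in> N" "x' \<in> N" "y \<in> C" "y' \<in> C" "x \<oplus>\<^bsub>V\<^esub> y = x' \<oplus>\<^bsub>V\<^esub> y'" for x x' y y'
  proof -
    have carr: "x \<in> carrier V" "x' \<in> carrier V" "y \<in> carrier V" "y' \<in> carrier V"
      using that sN sC by auto
    have "x = (x' \<oplus>\<^bsub>V\<^esub> y') \<oplus>\<^bsub>V\<^esub> \<ominus>\<^bsub>V\<^esub> y"
      using carr by (simp add: that(5)[symmetric] a_assoc r_neg)
    then have "x \<ominus>\<^bsub>V\<^esub> x' = (x' \<oplus>\<^bsub>V\<^esub> (y' \<oplus>\<^bsub>V\<^esub> \<ominus>\<^bsub>V\<^esub> y)) \<ominus>\<^bsub>V\<^esub> x'"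
      using carr by (simp add: a_assoc)
    also have "\<dots> = y' \<ominus>\<^bsub>V\<^esub> y"
      using carr by (simp add: a_minus_def a_comm[of x'] a_assoc r_neg)
    finally have "x \<ominus>\<^bsub>V\<^esub> x' \<in> N \<inter> C"
      using submodule_minus[OF N that(1,2)] submodule_minus[OF C(1) that(4,3)] by simp
    then show ?thesis using C(3) carr by simp
  qed
  define P where "P x = (THE n. n \<in> N \<and> (\<exists>c\<in>C. x = n \<oplus>\<^bsub>V\<^esub> c))" for x
  have P_eq: "P (n \<oplus>\<^bsub>V\<^esub> c) = n" if "n \<in> N" "c \<in> C" for n c
    unfolding P_def by (rule the_equality) (use that uniq in blast)+
  have dec: "\<exists>n\<in>N. \<exists>c\<in>C. x = n \<oplus>\<^bsub>V\<^esub> c" if "x \<in> carrier V" for x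
    using that C(4) by auto
  show ?thesis
  proof (intro bexI[of _ P] conjI ballI)
    show PN: "P x \<in> N" if "x \<in> carrier V" for x
      using dec[OF that] P_eq by auto
    show "P x = x" if "x \<in> N" for x
      using P_eq[OF that submodule.zero_closed[OF C(1)]] that sN by auto
    show "P x = \<zero>\<^bsub>V\<^esub>" if "x \<in> D" for x
    proof -
      have "x \<in> C" using that C(2) by blast
      then show ?thesis using P_eq[OF submodule.zero_closed[OF N], of x] sC by auto
    qed
    show "P \<in> module_hom K V V"
      unfolding module_hom_def
    proof (intro CollectI conjI allI impI)
      show "P \<in> carrier V \<rightarrow> carrier V" using PN sN by blast
    next
      fix x y assume xy: "x \<in> carrier V \<and> y \<in> carrier V"
      obtain n c n' c' where *: "n \<in> N" "c \<in> C" "x = n \<oplus>\<^bsub>V\<^esub> c" "n' \<in> N" "c' \<in> C" "y = n' \<oplus>\<^bsub>V\<^esub> c'"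
        using dec xy by meson
      have "x \<oplus>\<^bsub>V\<^esub> y = (n \<oplus>\<^bsub>V\<^esub> n') \<oplus>\<^bsub>V\<^esub> (c \<oplus>\<^bsub>V\<^esub> c')"
        using * sN sC by (simp add: a_ac subset_iff)
      then show "P (x \<oplus>\<^bsub>V\<^esub> y) = P x \<oplus>\<^bsub>V\<^esub> P y"
        using * P_eq submodule.m_closed[OF N] submodule.m_closed[OF C(1)] by simp
    next
      fix a x assume ax: "a \<in> carrier K \<and> x \<in> carrier V"
      obtain n c where *: "n \<in> N" "c \<in> C" "x = n \<oplus>\<^bsub>V\<^esub> c"
        using dec ax by meson
      have "a \<odot>\<^bsub>V\<^esub> x = a \<odot>\<^bsub>V\<^esub> n \<oplus>\<^bsub>V\<^esub> a \<odot>\<^bsub>V\<^esub> c"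
        using * sN sC ax by (simp add: smult_r_distr subset_iff)
      then show "P (a \<odot>\<^bsub>V\<^esub> x) = a \<odot>\<^bsub>V\<^esub> P x"
        using * ax P_eq submodule.smult_closed[OF N] submodule.smult_closed[OF C(1)] by simp
    qed
  qed
qed

text \<open>
  The projection onto a complement of \<open>N\<close> along \<open>N\<close>. It is used in place of the quotient by \<open>N\<close>, so
  that the values stay in the given space.
\<close>

lemma (in vectorspace) module_hom_with_kernel:
  assumes N: "submodule K N V"
  shows "\<exists>P \<in> module_hom K V V. \<forall>x\<in>carrier V. P x = \<zero>\<^bsub>V\<^esub> \<longleftrightarrow> x \<in> N"
proof -
  have "N \<inter> {\<zero>\<^bsub>V\<^esub>} = {\<zero>\<^bsub>V\<^esub>}" using submodule.zero_closed[OF N] by auto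
  then obtain C where C: "submodule K C V" "{\<zero>\<^bsub>V\<^esub>} \<subseteq> C" "N \<inter> C = {\<zero>\<^bsub>V\<^esub>}"
    "carrier V = {x \<oplus>\<^bsub>V\<^esub> y | x y. x \<in> N \<and> y \<in> C}"
    by (rule complement_containing[OF N trivial_submodule])
  then have "C \<inter> N = {\<zero>\<^bsub>V\<^esub>}" by (simp add: Int_commute)
  then obtain P where P: "P \<in> module_hom K V V" "\<forall>x\<in>carrier V. P x \<in> C"
    "\<forall>x\<in>C. P x = x" "\<forall>x\<in>N. P x = \<zero>\<^bsub>V\<^esub>"
    using projection_along[OF C(1) N] by blast
  show ?thesis
  proof (intro bexI[OF _ P(1)] ballI)
    fix x assume "x \<in> carrier V"
    then obtain n c where nc: "n \<in> N" "c \<in> C" "x = n \<oplus>\<^bsub>V\<^esub> c" using C(4) by auto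
    then have carr: "n \<in> carrier V" "c \<in> carrier V"
      using submodule.subset[OF N] submodule.subset[OF C(1)] by auto
    then have "P x = c"
      using nc P module_hom_add[OF P(1)] by simp
    then show "P x = \<zero>\<^bsub>V\<^esub> \<longleftrightarrow> x \<in> N"
      using nc carr P(4) by auto
  qed
qed

definition (in module) linear_form :: "('c \<Rightarrow> 'a) \<Rightarrow> bool" where
  "linear_form f \<longleftrightarrow> f \<in> carrier M \<rightarrow> carrier R \<and>
     (\<forall>x\<in>carrier M. \<forall>y\<in>carrier M. f (x \<oplus>\<^bsub>M\<^esub> y) = f x \<oplus>\<^bsub>R\<^esub> f y) \<and>
     (\<forall>a\<in>carrier R. \<forall>x\<in>carrier M. f (a \<odot>\<^bsub>M\<^esub> x) = a \<otimes>\<^bsub>R\<^esub> f x)"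

lemma (in vectorspace) smult_cancel_right:
  assumes "a \<in> carrier K" "b \<in> carrier K" "x \<in> carrier V" "x \<noteq> \<zero>\<^bsub>V\<^esub>"
    and "a \<odot>\<^bsub>V\<^esub> x = b \<odot>\<^bsub>V\<^esub> x"
  shows "a = b"
proof (rule ccontr)
  assume "a \<noteq> b"
  then have "a \<ominus>\<^bsub>K\<^esub> b \<noteq> \<zero>\<^bsub>K\<^esub>" using assms by simp
  moreover have "(a \<ominus>\<^bsub>K\<^esub> b) \<odot>\<^bsub>V\<^esub> x = \<zero>\<^bsub>V\<^esub>"
    using assms by (simp add: a_minus_def smult_l_distr smult_l_minus r_neg)
  ultimately have "x \<in> {\<zero>\<^bsub>V\<^esub>}"
    using submodule_smult_cancel[OF trivial_submodule, of "a \<ominus>\<^bsub>K\<^esub> b" x] assms by simp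
  then show False using assms by simp
qed

text \<open>
  Project onto the line spanned by \<open>u\<close> along a subspace containing \<open>S\<close>, and read off the coefficient
  of \<open>u\<close>.
\<close>

lemma (in vectorspace) separating_linear_form:
  assumes S: "submodule K S V" and u: "u \<in> carrier V" "u \<notin> S"
  shows "\<exists>f. linear_form f \<and> (\<forall>x\<in>S. f x = \<zero>\<^bsub>K\<^esub>) \<and> f u = \<one>\<^bsub>K\<^esub>"
proof -
  let ?N = "{a \<odot>\<^bsub>V\<^esub> u | a. a \<in> carrier K}"
  have N: "submodule K ?N V" by (rule line_submodule[OF u(1)])
  have u0: "u \<noteq> \<zero>\<^bsub>V\<^esub>" using u submodule.zero_closed[OF S] by auto
  have "?N \<inter> S = {\<zero>\<^bsub>V\<^esub>}"
  proof -
    have "a \<odot>\<^bsub>V\<^esub> u = \<zero>\<^bsub>V\<^esub>" if "a \<in> carrier K" "a \<odot>\<^bsub>V\<^esub> u \<in> S" for a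
    proof -
      have "a = \<zero>\<^bsub>K\<^esub>"
        using submodule_smult_cancel[OF S that(1) _ u(1) that(2)] u by blast
      then show ?thesis using u by simp
    qed
    then have "?N \<inter> S \<subseteq> {\<zero>\<^bsub>V\<^esub>}" by blast
    then show ?thesis
      using submodule.zero_closed[OF S] submodule.zero_closed[OF N] by blast
  qed
  then obtain P where P: "P \<in> module_hom K V V" "\<forall>x\<in>carrier V. P x \<in> ?N"
    "\<forall>x\<in>?N. P x = x" "\<forall>x\<in>S. P x = \<zero>\<^bsub>V\<^esub>"
    using projection_along[OF N S] by blast
  define f where "f x = (THE a. a \<in> carrier K \<and> P x = a \<odot>\<^bsub>V\<^esub> u)" for x
  have f_eq: "f x = a" if "a \<in> carrier K" "P x = a \<odot>\<^bsub>V\<^esub> u" for x a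
    unfolding f_def
  proof (rule the_equality)
    show "b = a" if b: "b \<in> carrier K \<and> P x = b \<odot>\<^bsub>V\<^esub> u" for b
      using b \<open>a \<in> carrier K\<close> \<open>P x = a \<odot>\<^bsub>V\<^esub> u\<close>
      by (intro smult_cancel_right[OF _ _ u(1) u0]) simp_all
  qed (use that in simp)
  have f: "f x \<in> carrier K" "P x = f x \<odot>\<^bsub>V\<^esub> u" if "x \<in> carrier V" for x
  proof -
    obtain a where "a \<in> carrier K" "P x = a \<odot>\<^bsub>V\<^esub> u" using P(2) \<open>x \<in> carrier V\<close> by blast
    then show "f x \<in> carrier K" "P x = f x \<odot>\<^bsub>V\<^esub> u" using f_eq by simp_all
  qed
  show ?thesis
  proof (intro exI[of _ f] conjI ballI)
    show "linear_form f"
      unfolding linear_form_def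
    proof (intro conjI ballI)
      show "f \<in> carrier V \<rightarrow> carrier K" using f by blast
      show "f (x \<oplus>\<^bsub>V\<^esub> y) = f x \<oplus>\<^bsub>K\<^esub> f y" if "x \<in> carrier V" "y \<in> carrier V" for x y
        using that f(1) u
        by (intro f_eq) (simp_all add: module_hom_add[OF P(1)] f(2)[OF that(1)] f(2)[OF that(2)] smult_l_distr)
      show "f (a \<odot>\<^bsub>V\<^esub> x) = a \<otimes>\<^bsub>K\<^esub> f x" if "a \<in> carrier K" "x \<in> carrier V" for a x
        using that f(1) u
        by (intro f_eq) (simp_all add: module_hom_smult[OF P(1)] f(2)[OF that(2)] smult_assoc1)
    qed
    show "f x = \<zero>\<^bsub>K\<^esub>" if "x \<in> S" for x
      using that P(4) u by (intro f_eq) simp_all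
    have "\<one>\<^bsub>K\<^esub> \<odot>\<^bsub>V\<^esub> u \<in> ?N" by blast
    then have "P u = u" using P(3) u by simp
    then show "f u = \<one>\<^bsub>K\<^esub>" using u by (intro f_eq) simp_all
  qed
qed

lemma (in vectorspace) equalizer_submodule:
  assumes "f \<in> module_hom K V V" "g \<in> module_hom K V V"
  shows "submodule K {x \<in> carrier V. f x = g x} V"
proof -
  interpret f: mod_hom K V V f using assms by unfold_locales
  interpret g: mod_hom K V V g using assms by unfold_locales
  show ?thesis by (rule submodule.intro) (auto simp: module_axioms)
qed

section \<open>The quotient by the center\<close>

context lie_algebra
begin

abbreviation "Z \<equiv> lie_center L"

lemma bracket_zero_left: "x \<in> carrier L \<Longrightarrow> \<zero>\<^bsub>L\<^esub> \<otimes>\<^bsub>L\<^esub> x = \<zero>\<^bsub>L\<^esub>"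
  using bracket_smult_left[of "\<zero>\<^bsub>K\<^esub>" x x] bracket_closed by simp

lemma bracket_antisym:
  assumes "x \<in> carrier L" "y \<in> carrier L"
  shows "x \<otimes>\<^bsub>L\<^esub> y = \<ominus>\<^bsub>L\<^esub> (y \<otimes>\<^bsub>L\<^esub> x)"
proof -
  have "\<zero>\<^bsub>L\<^esub> = (x \<oplus>\<^bsub>L\<^esub> y) \<otimes>\<^bsub>L\<^esub> (x \<oplus>\<^bsub>L\<^esub> y)"
    using assms by (simp add: bracket_self)
  also have "\<dots> = x \<otimes>\<^bsub>L\<^esub> y \<oplus>\<^bsub>L\<^esub> y \<otimes>\<^bsub>L\<^esub> x"
    using assms by (simp add: bracket_add_left bracket_add_right bracket_closed
        bracket_self[of x] bracket_self[of y] M.a_comm)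
  finally show ?thesis
    using assms bracket_closed by (metis M.minus_equality)
qed

lemma center_carrier: "z \<in> Z \<Longrightarrow> z \<in> carrier L"
  by (simp add: lie_center_def)

lemma center_left: "z \<in> Z \<Longrightarrow> x \<in> carrier L \<Longrightarrow> z \<otimes>\<^bsub>L\<^esub> x = \<zero>\<^bsub>L\<^esub>"
  by (simp add: lie_center_def)

lemma center_right: "z \<in> Z \<Longrightarrow> x \<in> carrier L \<Longrightarrow> x \<otimes>\<^bsub>L\<^esub> z = \<zero>\<^bsub>L\<^esub>"
  using bracket_antisym[of x z] by (simp add: center_left center_carrier)

lemma center_submodule: "submodule K Z L"
  by (rule submodule.intro)
    (auto simp: lie_center_def module_axioms bracket_add_left bracket_smult_left bracket_zero_left)

lemma center_subgroup: "abelian_subgroup Z L"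
proof (rule abelian_subgroupI3)
  show "additive_subgroup Z L"
  proof (rule additive_subgroupI, rule group.subgroupI[OF a_group])
    show "inv\<^bsub>add_monoid L\<^esub> a \<in> Z" if "a \<in> Z" for a
      using submodule_neg[OF center_submodule that] by (simp add: a_inv_def)
  qed (use center_submodule center_carrier in \<open>auto simp: submodule_def\<close>)
qed (rule M.abelian_group_axioms)

abbreviation "coset x \<equiv> Z +>\<^bsub>L\<^esub> x"

lemma mem_coset: "x \<in> carrier L \<Longrightarrow> y \<in> coset x \<longleftrightarrow> (\<exists>z\<in>Z. y = z \<oplus>\<^bsub>L\<^esub> x)"
  by (auto simp: a_r_coset_def r_coset_def)

lemma coset_self: "x \<in> carrier L \<Longrightarrow> x \<in> coset x"
  by (rule abelian_subgroup.a_rcos_self[OF center_subgroup])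

lemma coset_eq_iff:
  assumes "x \<in> carrier L" "y \<in> carrier L"
  shows "coset x = coset y \<longleftrightarrow> x \<ominus>\<^bsub>L\<^esub> y \<in> Z"
proof -
  interpret C: abelian_subgroup Z L by (rule center_subgroup)
  have "x \<ominus>\<^bsub>L\<^esub> y \<in> Z \<longleftrightarrow> x \<in> coset y"
    using assms by (simp add: C.a_rcos_module a_minus_def)
  also have "\<dots> \<longleftrightarrow> coset x = coset y"
  proof
    assume "x \<in> coset y"
    then show "coset x = coset y"
      using M.a_repr_independence'[OF _ assms(2) C.a_subgroup, of x] by (simp add: a_r_coset_def)
  qed (use coset_self[OF assms(1)] in simp)
  finally show ?thesis by simp
qed

lemma coset_add:
  assumes "x \<in> carrier L" "y \<in> carrier L"
  shows "coset x \<oplus>\<^bsub>lie_quotient L Z\<^esub> coset y = coset (x \<oplus>\<^bsub>L\<^esub> y)"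
  using abelian_subgroup.a_rcos_sum[OF center_subgroup assms] by (simp add: lie_quotient_def)

lemma coset_smult:
  assumes "a \<in> carrier K" "x \<in> carrier L"
  shows "a \<odot>\<^bsub>lie_quotient L Z\<^esub> coset x = coset (a \<odot>\<^bsub>L\<^esub> x)"
proof -
  have "coset (a \<odot>\<^bsub>L\<^esub> y) = coset (a \<odot>\<^bsub>L\<^esub> x)" if "y \<in> coset x" for y
  proof -
    obtain z where z: "z \<in> Z" "y = z \<oplus>\<^bsub>L\<^esub> x" using \<open>y \<in> coset x\<close> mem_coset assms by blast
    then have "a \<odot>\<^bsub>L\<^esub> y \<ominus>\<^bsub>L\<^esub> a \<odot>\<^bsub>L\<^esub> x = a \<odot>\<^bsub>L\<^esub> z"
      using assms center_carrier by (simp add: smult_r_distr a_minus_def M.a_assoc M.r_neg)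
    also have "\<dots> \<in> Z" using z assms center_submodule by (simp add: submodule.smult_closed)
    finally show ?thesis
      using z assms center_carrier by (subst coset_eq_iff) simp_all
  qed
  then have "(\<Union>y\<in>coset x. coset (a \<odot>\<^bsub>L\<^esub> y)) = (\<Union>y\<in>coset x. coset (a \<odot>\<^bsub>L\<^esub> x))" by simp
  then show ?thesis
    using coset_self[OF assms(2)] by (auto simp: lie_quotient_def)
qed

text \<open>
  Central summands do not change a bracket, so the union that defines the product of two cosets has
  only one member.
\<close>

lemma coset_bracket:
  assumes "x \<in> carrier L" "y \<in> carrier L"
  shows "coset x \<otimes>\<^bsub>lie_quotient L Z\<^esub> coset y = coset (x \<otimes>\<^bsub>L\<^esub> y)"
proof -
  have "x' \<otimes>\<^bsub>L\<^esub> y' = x \<otimes>\<^bsub>L\<^esub> y" if "x' \<in> coset x" "y' \<in> coset y" for x' y'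
  proof -
    obtain z w where "z \<in> Z" "x' = z \<oplus>\<^bsub>L\<^esub> x" "w \<in> Z" "y' = w \<oplus>\<^bsub>L\<^esub> y"
      using \<open>x' \<in> coset x\<close> \<open>y' \<in> coset y\<close> mem_coset assms by blast
    then show ?thesis
      using assms center_carrier
      by (simp add: bracket_add_left bracket_add_right center_left center_right bracket_closed)
  qed
  then have "(\<Union>x'\<in>coset x. \<Union>y'\<in>coset y. coset (x' \<otimes>\<^bsub>L\<^esub> y')) =
      (\<Union>x'\<in>coset x. \<Union>y'\<in>coset y. coset (x \<otimes>\<^bsub>L\<^esub> y))" by simp
  then show ?thesis
    using coset_self[OF assms(1)] coset_self[OF assms(2)]
    by (auto simp: lie_quotient_def rcoset_mult_def)
qed

lemma carrier_quotient: "carrier (lie_quotient L Z) = coset ` carrier L"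
  by (auto simp: lie_quotient_def A_RCOSETS_def RCOSETS_def a_r_coset_def)

lemma zero_quotient: "\<zero>\<^bsub>lie_quotient L Z\<^esub> = coset \<zero>\<^bsub>L\<^esub>"
  using abelian_subgroup.a_rcos_const[OF center_subgroup, of "\<zero>\<^bsub>L\<^esub>"]
    submodule.zero_closed[OF center_submodule]
  by (simp add: lie_quotient_def)

lemma quotient_vectorspace: "vectorspace K (lie_quotient L Z)"
proof (rule vs_criteria)
  let ?Q = "lie_quotient L Z"
  note simps = carrier_quotient zero_quotient coset_add coset_smult
  show "field K" by (rule field_axioms)
  show "\<zero>\<^bsub>?Q\<^esub> \<in> carrier ?Q" by (simp add: simps)
  show "\<forall>v w. v \<in> carrier ?Q \<and> w \<in> carrier ?Q \<longrightarrow> v \<oplus>\<^bsub>?Q\<^esub> w \<in> carrier ?Q"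
    by (auto simp: simps)
  show "\<forall>v\<in>carrier ?Q. \<exists>neg_v\<in>carrier ?Q. v \<oplus>\<^bsub>?Q\<^esub> neg_v = \<zero>\<^bsub>?Q\<^esub>"
  proof
    fix v assume "v \<in> carrier ?Q"
    then obtain x where x: "x \<in> carrier L" "v = coset x" by (auto simp: simps)
    then have "v \<oplus>\<^bsub>?Q\<^esub> coset (\<ominus>\<^bsub>L\<^esub> x) = \<zero>\<^bsub>?Q\<^esub>" by (simp add: simps M.r_neg)
    then show "\<exists>neg_v\<in>carrier ?Q. v \<oplus>\<^bsub>?Q\<^esub> neg_v = \<zero>\<^bsub>?Q\<^esub>"
      using x by (auto simp: carrier_quotient)
  qed
  show "\<forall>c v. c \<in> carrier K \<and> v \<in> carrier ?Q \<longrightarrow> c \<odot>\<^bsub>?Q\<^esub> v \<in> carrier ?Q"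
    by (auto simp: simps)
  show "\<forall>v w. v \<in> carrier ?Q \<and> w \<in> carrier ?Q \<longrightarrow> v \<oplus>\<^bsub>?Q\<^esub> w = w \<oplus>\<^bsub>?Q\<^esub> v"
    by (auto simp: simps M.a_comm)
  show "\<forall>v w x. v \<in> carrier ?Q \<and> w \<in> carrier ?Q \<and> x \<in> carrier ?Q \<longrightarrow>
      v \<oplus>\<^bsub>?Q\<^esub> w \<oplus>\<^bsub>?Q\<^esub> x = v \<oplus>\<^bsub>?Q\<^esub> (w \<oplus>\<^bsub>?Q\<^esub> x)"
    by (auto simp: simps M.a_assoc)
  show "\<forall>v\<in>carrier ?Q. v \<oplus>\<^bsub>?Q\<^esub> \<zero>\<^bsub>?Q\<^esub> = v"
    by (auto simp: simps)
  show "\<forall>a b v. a \<in> carrier K \<and> b \<in> carrier K \<and> v \<in> carrier ?Q \<longrightarrow>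
      (a \<otimes>\<^bsub>K\<^esub> b) \<odot>\<^bsub>?Q\<^esub> v = a \<odot>\<^bsub>?Q\<^esub> (b \<odot>\<^bsub>?Q\<^esub> v)"
    by (auto simp: simps smult_assoc1)
  show "\<forall>v\<in>carrier ?Q. \<one>\<^bsub>K\<^esub> \<odot>\<^bsub>?Q\<^esub> v = v"
    by (auto simp: simps)
  show "\<forall>a b v. a \<in> carrier K \<and> b \<in> carrier K \<and> v \<in> carrier ?Q \<longrightarrow>
      (a \<oplus>\<^bsub>K\<^esub> b) \<odot>\<^bsub>?Q\<^esub> v = a \<odot>\<^bsub>?Q\<^esub> v \<oplus>\<^bsub>?Q\<^esub> b \<odot>\<^bsub>?Q\<^esub> v"
    by (auto simp: simps smult_l_distr)
  show "\<forall>a v w. a \<in> carrier K \<and> v \<in> carrier ?Q \<and> w \<in> carrier ?Q \<longrightarrow>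
      a \<odot>\<^bsub>?Q\<^esub> (v \<oplus>\<^bsub>?Q\<^esub> w) = a \<odot>\<^bsub>?Q\<^esub> v \<oplus>\<^bsub>?Q\<^esub> a \<odot>\<^bsub>?Q\<^esub> w"
    by (auto simp: simps smult_r_distr)
qed

lemma coset_image_submodule:
  assumes M: "submodule K M L"
  shows "submodule K (coset ` M) (lie_quotient L Z)"
proof (rule submodule.intro)
  let ?Q = "lie_quotient L Z"
  note sM = submodule.subset[OF M]
  show "module K ?Q" using quotient_vectorspace by (rule vectorspace.axioms(1))
  show "coset ` M \<subseteq> carrier ?Q" using sM by (auto simp: carrier_quotient)
  show "v \<oplus>\<^bsub>?Q\<^esub> w \<in> coset ` M" if vw: "v \<in> coset ` M" "w \<in> coset ` M" for v w
  proof -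
    obtain x y where xy: "x \<in> M" "v = coset x" "y \<in> M" "w = coset y" using vw by auto
    then have "v \<oplus>\<^bsub>?Q\<^esub> w = coset (x \<oplus>\<^bsub>L\<^esub> y)" using sM by (simp add: coset_add subset_iff)
    then show ?thesis using xy submodule.m_closed[OF M] by blast
  qed
  show "\<zero>\<^bsub>?Q\<^esub> \<in> coset ` M"
    using submodule.zero_closed[OF M] by (simp add: zero_quotient)
  show "c \<odot>\<^bsub>?Q\<^esub> v \<in> coset ` M" if cv: "c \<in> carrier K" "v \<in> coset ` M" for c v
  proof -
    obtain x where x: "x \<in> M" "v = coset x" using cv by auto
    then have "c \<odot>\<^bsub>?Q\<^esub> v = coset (c \<odot>\<^bsub>L\<^esub> x)" using sM cv by (simp add: coset_smult subset_iff)
    then show ?thesis using x cv submodule.smult_closed[OF M] by blast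
  qed
qed

lemma coset_preimage_submodule:
  assumes N: "submodule K N (lie_quotient L Z)"
  shows "submodule K {x \<in> carrier L. coset x \<in> N} L"
proof (rule submodule.intro)
  show "module K L" by (rule module_axioms)
  show "\<zero>\<^bsub>L\<^esub> \<in> {x \<in> carrier L. coset x \<in> N}"
    using submodule.zero_closed[OF N] by (simp add: zero_quotient)
  show "v \<oplus>\<^bsub>L\<^esub> w \<in> {x \<in> carrier L. coset x \<in> N}"
    if "v \<in> {x \<in> carrier L. coset x \<in> N}" "w \<in> {x \<in> carrier L. coset x \<in> N}" for v w
    using that submodule.m_closed[OF N, of "coset v" "coset w"] by (simp add: coset_add)
  show "c \<odot>\<^bsub>L\<^esub> v \<in> {x \<in> carrier L. coset x \<in> N}"
    if "c \<in> carrier K" "v \<in> {x \<in> carrier L. coset x \<in> N}" for c v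
    using that submodule.smult_closed[OF N, of c "coset v"] by (simp add: coset_smult)
qed auto

text \<open>
  Lift a basis of the quotient. The subspace that the lifts span together with \<open>Z\<close> maps onto the
  quotient and contains the kernel \<open>Z\<close>, so it is everything.
\<close>

lemma generators_mod_center:
  assumes fin: "fin_dim" and d: "vectorspace.dim K (lie_quotient L Z) = d"
  shows "\<exists>B. finite B \<and> B \<subseteq> carrier L \<and> card B \<le> d \<and> span (B \<union> Z) = carrier L"
proof -
  let ?Q = "lie_quotient L Z"
  interpret Q: vectorspace K ?Q by (rule quotient_vectorspace)
  obtain A where A: "finite A" "A \<subseteq> carrier L" "span A = carrier L"
    using fin by (auto simp: fin_dim_def)
  have "Q.fin_dim"
    unfolding Q.fin_dim_def
  proof (intro exI[of _ "coset ` A"] conjI)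
    show sub: "coset ` A \<subseteq> carrier ?Q" using A by (auto simp: carrier_quotient)
    let ?N = "{x \<in> carrier L. coset x \<in> Q.span (coset ` A)}"
    have "submodule K ?N L"
      by (rule coset_preimage_submodule[OF Q.span_is_submodule[OF sub]])
    moreover have "A \<subseteq> ?N" using A Q.in_own_span[OF sub] by auto
    ultimately have "span A \<subseteq> ?N" by (rule span_is_subset[rotated])
    then show "Q.span (coset ` A) = carrier ?Q"
      using A(3) Q.span_is_subset2[OF sub] by (auto simp: carrier_quotient)
  qed (use A in simp)
  then obtain S where S: "finite S" "Q.basis S" using Q.finite_basis_exists by blast
  then have S': "S \<subseteq> carrier ?Q" "Q.span S = carrier ?Q" "card S = d"
    using d Q.dim_basis[OF S] by (simp_all add: Q.basis_def)
  have "\<forall>X\<in>S. \<exists>x. x \<in> carrier L \<and> coset x = X"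
    using S'(1) unfolding carrier_quotient by blast
  from bchoice[OF this] obtain r where
    r: "\<And>X. X \<in> S \<Longrightarrow> r X \<in> carrier L \<and> coset (r X) = X" by blast
  let ?B = "r ` S"
  have BZ: "?B \<union> Z \<subseteq> carrier L" using r center_carrier by auto
  have sub: "submodule K (span (?B \<union> Z)) L" by (rule span_is_submodule[OF BZ])
  have "S \<subseteq> coset ` span (?B \<union> Z)"
  proof
    fix X assume "X \<in> S"
    then have "coset (r X) = X" "r X \<in> span (?B \<union> Z)"
      using r in_own_span[OF BZ] by auto
    then show "X \<in> coset ` span (?B \<union> Z)" by force
  qed
  then have "Q.span S \<subseteq> coset ` span (?B \<union> Z)"
    by (rule Q.span_is_subset[OF _ coset_image_submodule[OF sub]])
  then have cos: "coset ` carrier L \<subseteq> coset ` span (?B \<union> Z)"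
    using S'(2) by (simp add: carrier_quotient)
  have "x \<in> span (?B \<union> Z)" if x: "x \<in> carrier L" for x
  proof -
    obtain y where y: "y \<in> span (?B \<union> Z)" "coset x = coset y" using cos x by blast
    then have yL: "y \<in> carrier L" using submodule.subset[OF sub] by blast
    then obtain z where z: "z \<in> Z" "x = z \<oplus>\<^bsub>L\<^esub> y"
      using coset_self[OF x] y mem_coset by blast
    then have "z \<in> span (?B \<union> Z)" using in_own_span[OF BZ] by blast
    then show ?thesis using z y submodule.m_closed[OF sub] by blast
  qed
  then have "span (?B \<union> Z) = carrier L" using submodule.subset[OF sub] by blast
  moreover have "card ?B \<le> d" using card_image_le[OF S(1)] S'(3) by blast
  ultimately show ?thesis using S(1) BZ by blast
qed

end

section \<open>Central extensions by a power of the Lie algebra\<close>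

text \<open>
  The direct power \<open>V\<^sup>n\<close>, as lists of length \<open>n\<close>. A module record carries a multiplication; the
  constant one chosen here is a placeholder that the extension below overwrites.
\<close>

definition list_power :: "('k, 'a, 'm) module_scheme \<Rightarrow> nat \<Rightarrow> ('k, 'a list) module" where
  "list_power V n = \<lparr>carrier = {xs. length xs = n \<and> set xs \<subseteq> carrier V},
     mult = (\<lambda>_ _. replicate n \<zero>\<^bsub>V\<^esub>), one = replicate n \<zero>\<^bsub>V\<^esub>,
     zero = replicate n \<zero>\<^bsub>V\<^esub>, add = map2 (\<oplus>\<^bsub>V\<^esub>), smult = (\<lambda>a. map ((\<odot>\<^bsub>V\<^esub>) a))\<rparr>"

lemma list_power_carrier:
  "xs \<in> carrier (list_power V n) \<longleftrightarrow> length xs = n \<and> (\<forall>i<n. xs ! i \<in> carrier V)"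
  by (auto simp: list_power_def set_conv_nth)

lemma list_power_nth_zero: "i < n \<Longrightarrow> \<zero>\<^bsub>list_power V n\<^esub> ! i = \<zero>\<^bsub>V\<^esub>"
  by (simp add: list_power_def)

lemma list_power_nth_add:
  assumes "xs \<in> carrier (list_power V n)" "ys \<in> carrier (list_power V n)" "i < n"
  shows "(xs \<oplus>\<^bsub>list_power V n\<^esub> ys) ! i = xs ! i \<oplus>\<^bsub>V\<^esub> ys ! i"
  using assms by (simp add: list_power_def)

lemma list_power_nth_smult:
  assumes "xs \<in> carrier (list_power V n)" "i < n"
  shows "(a \<odot>\<^bsub>list_power V n\<^esub> xs) ! i = a \<odot>\<^bsub>V\<^esub> xs ! i"
  using assms by (simp add: list_power_def)

lemma list_power_eqI:
  assumes "xs \<in> carrier (list_power V n)" "ys \<in> carrier (list_power V n)"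
    and "\<And>i. i < n \<Longrightarrow> xs ! i = ys ! i"
  shows "xs = ys"
  using assms by (auto simp: list_power_carrier intro: nth_equalityI)

lemma (in vectorspace) list_power_vectorspace: "vectorspace K (list_power V n)"
proof (rule vs_criteria)
  let ?U = "list_power V n"
  note nth = list_power_nth_zero list_power_nth_add list_power_nth_smult
  have zero: "\<zero>\<^bsub>?U\<^esub> \<in> carrier ?U"
    by (auto simp: list_power_def)
  have add: "xs \<oplus>\<^bsub>?U\<^esub> ys \<in> carrier ?U" if "xs \<in> carrier ?U" "ys \<in> carrier ?U" for xs ys
    using that by (auto simp: list_power_carrier) (auto simp: list_power_def)
  have smult: "a \<odot>\<^bsub>?U\<^esub> xs \<in> carrier ?U" if "a \<in> carrier K" "xs \<in> carrier ?U" for a xs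
    using that by (auto simp: list_power_carrier) (auto simp: list_power_def)
  have elem: "xs ! i \<in> carrier V" if "xs \<in> carrier ?U" "i < n" for xs i
    using that by (simp add: list_power_carrier)
  show "field K" by (rule field_axioms)
  show "\<zero>\<^bsub>?U\<^esub> \<in> carrier ?U" by (rule zero)
  show "\<forall>v w. v \<in> carrier ?U \<and> w \<in> carrier ?U \<longrightarrow> v \<oplus>\<^bsub>?U\<^esub> w \<in> carrier ?U"
    using add by blast
  show "\<forall>c v. c \<in> carrier K \<and> v \<in> carrier ?U \<longrightarrow> c \<odot>\<^bsub>?U\<^esub> v \<in> carrier ?U"
    using smult by blast
  show "\<forall>v\<in>carrier ?U. \<exists>neg_v\<in>carrier ?U. v \<oplus>\<^bsub>?U\<^esub> neg_v = \<zero>\<^bsub>?U\<^esub>"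
  proof
    fix v assume v: "v \<in> carrier ?U"
    let ?w = "(\<ominus>\<^bsub>K\<^esub> \<one>\<^bsub>K\<^esub>) \<odot>\<^bsub>?U\<^esub> v"
    have w: "?w \<in> carrier ?U" using v by (simp add: smult)
    have "v \<oplus>\<^bsub>?U\<^esub> ?w = \<zero>\<^bsub>?U\<^esub>"
      using v w by (intro list_power_eqI[OF add[OF v w] zero])
        (simp add: nth elem smult_minus_1 M.r_neg)
    then show "\<exists>neg_v\<in>carrier ?U. v \<oplus>\<^bsub>?U\<^esub> neg_v = \<zero>\<^bsub>?U\<^esub>" using w by blast
  qed
  show "\<forall>v w. v \<in> carrier ?U \<and> w \<in> carrier ?U \<longrightarrow> v \<oplus>\<^bsub>?U\<^esub> w = w \<oplus>\<^bsub>?U\<^esub> v"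
    by (intro allI impI list_power_eqI[where V = V and n = n]) (auto simp: add nth elem M.a_comm)
  show "\<forall>v w x. v \<in> carrier ?U \<and> w \<in> carrier ?U \<and> x \<in> carrier ?U \<longrightarrow>
      v \<oplus>\<^bsub>?U\<^esub> w \<oplus>\<^bsub>?U\<^esub> x = v \<oplus>\<^bsub>?U\<^esub> (w \<oplus>\<^bsub>?U\<^esub> x)"
    by (intro allI impI list_power_eqI[where V = V and n = n]) (auto simp: add nth elem M.a_assoc)
  show "\<forall>v\<in>carrier ?U. v \<oplus>\<^bsub>?U\<^esub> \<zero>\<^bsub>?U\<^esub> = v"
    by (intro ballI list_power_eqI[where V = V and n = n]) (auto simp: add zero nth elem)
  show "\<forall>a b v. a \<in> carrier K \<and> b \<in> carrier K \<and> v \<in> carrier ?U \<longrightarrow>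
      (a \<otimes>\<^bsub>K\<^esub> b) \<odot>\<^bsub>?U\<^esub> v = a \<odot>\<^bsub>?U\<^esub> (b \<odot>\<^bsub>?U\<^esub> v)"
    by (intro allI impI list_power_eqI[where V = V and n = n])
      (auto simp: smult nth elem smult_assoc1)
  show "\<forall>v\<in>carrier ?U. \<one>\<^bsub>K\<^esub> \<odot>\<^bsub>?U\<^esub> v = v"
    by (intro ballI list_power_eqI[where V = V and n = n]) (auto simp: smult nth elem)
  show "\<forall>a b v. a \<in> carrier K \<and> b \<in> carrier K \<and> v \<in> carrier ?U \<longrightarrow>
      (a \<oplus>\<^bsub>K\<^esub> b) \<odot>\<^bsub>?U\<^esub> v = a \<odot>\<^bsub>?U\<^esub> v \<oplus>\<^bsub>?U\<^esub> b \<odot>\<^bsub>?U\<^esub> v"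
    by (intro allI impI list_power_eqI[where V = V and n = n])
      (auto simp: add smult nth elem smult_l_distr)
  show "\<forall>a v w. a \<in> carrier K \<and> v \<in> carrier ?U \<and> w \<in> carrier ?U \<longrightarrow>
      a \<odot>\<^bsub>?U\<^esub> (v \<oplus>\<^bsub>?U\<^esub> w) = a \<odot>\<^bsub>?U\<^esub> v \<oplus>\<^bsub>?U\<^esub> a \<odot>\<^bsub>?U\<^esub> w"
    by (intro allI impI list_power_eqI[where V = V and n = n])
      (auto simp: add smult nth elem smult_r_distr)
qed

text \<open>
  Alternating 2-cocycles with values in \<open>L\<^sup>n\<close>, on which \<open>L\<close> acts trivially. Values in a power of \<open>L\<close>
  make the total space \<open>L \<oplus> L\<^sup>n = L\<^bsup>n+1\<^esup>\<close> of the extension a set of lists over \<open>L\<close>.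
\<close>

locale lie_cocycle = lie_algebra +
  fixes n :: nat and b :: "'c \<Rightarrow> 'c \<Rightarrow> 'c list"
  assumes cocycle_closed: "\<lbrakk>x \<in> carrier L; y \<in> carrier L\<rbrakk> \<Longrightarrow> b x y \<in> carrier (list_power L n)"
    and cocycle_add_left: "\<lbrakk>x \<in> carrier L; y \<in> carrier L; z \<in> carrier L\<rbrakk> \<Longrightarrow>
      b (x \<oplus>\<^bsub>L\<^esub> y) z = b x z \<oplus>\<^bsub>list_power L n\<^esub> b y z"
    and cocycle_add_right: "\<lbrakk>x \<in> carrier L; y \<in> carrier L; z \<in> carrier L\<rbrakk> \<Longrightarrow>
      b x (y \<oplus>\<^bsub>L\<^esub> z) = b x y \<oplus>\<^bsub>list_power L n\<^esub> b x z"
    and cocycle_smult_left: "\<lbrakk>a \<in> carrier K; x \<in> carrier L; y \<in> carrier L\<rbrakk> \<Longrightarrow>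
      b (a \<odot>\<^bsub>L\<^esub> x) y = a \<odot>\<^bsub>list_power L n\<^esub> b x y"
    and cocycle_smult_right: "\<lbrakk>a \<in> carrier K; x \<in> carrier L; y \<in> carrier L\<rbrakk> \<Longrightarrow>
      b x (a \<odot>\<^bsub>L\<^esub> y) = a \<odot>\<^bsub>list_power L n\<^esub> b x y"
    and cocycle_self: "x \<in> carrier L \<Longrightarrow> b x x = \<zero>\<^bsub>list_power L n\<^esub>"
    and cocycle_jacobi: "\<lbrakk>x \<in> carrier L; y \<in> carrier L; z \<in> carrier L\<rbrakk> \<Longrightarrow>
      b x (y \<otimes>\<^bsub>L\<^esub> z) \<oplus>\<^bsub>list_power L n\<^esub> b y (z \<otimes>\<^bsub>L\<^esub> x) \<oplus>\<^bsub>list_power L n\<^esub> b z (x \<otimes>\<^bsub>L\<^esub> y)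
        = \<zero>\<^bsub>list_power L n\<^esub>"
begin

abbreviation "U \<equiv> list_power L n"

definition extension :: "('a, 'c list) module" where
  "extension = (list_power L (Suc n))
     \<lparr>mult := \<lambda>xs ys. (hd xs \<otimes>\<^bsub>L\<^esub> hd ys) # b (hd xs) (hd ys)\<rparr>"

lemma carrier_extension:
  "carrier extension = {x # u | x u. x \<in> carrier L \<and> u \<in> carrier U}"
proof -
  have "xs \<in> carrier extension \<longleftrightarrow> (\<exists>x u. xs = x # u \<and> x \<in> carrier L \<and> u \<in> carrier U)" for xs
    by (cases xs) (auto simp: extension_def list_power_def)
  then show ?thesis by auto
qed

lemma extension_ops:
  "\<zero>\<^bsub>extension\<^esub> = \<zero>\<^bsub>L\<^esub> # \<zero>\<^bsub>U\<^esub>"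
  "(x # u) \<oplus>\<^bsub>extension\<^esub> (y # v) = (x \<oplus>\<^bsub>L\<^esub> y) # (u \<oplus>\<^bsub>U\<^esub> v)"
  "a \<odot>\<^bsub>extension\<^esub> (x # u) = (a \<odot>\<^bsub>L\<^esub> x) # (a \<odot>\<^bsub>U\<^esub> u)"
  "(x # u) \<otimes>\<^bsub>extension\<^esub> (y # v) = (x \<otimes>\<^bsub>L\<^esub> y) # b x y"
  by (simp_all add: extension_def list_power_def)

lemma extension_vectorspace: "vectorspace K extension"
proof -
  interpret U: vectorspace K U by (rule list_power_vectorspace)
  note simps = carrier_extension extension_ops
  have neg: "\<forall>v\<in>carrier extension. \<exists>neg_v\<in>carrier extension. v \<oplus>\<^bsub>extension\<^esub> neg_v = \<zero>\<^bsub>extension\<^esub>"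
  proof
    fix v assume "v \<in> carrier extension"
    then obtain x u where xu: "v = x # u" "x \<in> carrier L" "u \<in> carrier U" by (auto simp: simps)
    then have "v \<oplus>\<^bsub>extension\<^esub> (\<ominus>\<^bsub>L\<^esub> x # \<ominus>\<^bsub>U\<^esub> u) = \<zero>\<^bsub>extension\<^esub>"
      by (simp add: simps M.r_neg U.M.r_neg)
    moreover have "\<ominus>\<^bsub>L\<^esub> x # \<ominus>\<^bsub>U\<^esub> u \<in> carrier extension" using xu by (simp add: simps)
    ultimately show "\<exists>neg_v\<in>carrier extension. v \<oplus>\<^bsub>extension\<^esub> neg_v = \<zero>\<^bsub>extension\<^esub>" by blast
  qed
  show ?thesis
    by (rule vs_criteria[OF field_axioms _ _ neg])
      (auto simp: simps M.a_ac U.M.a_ac smult_assoc1 U.smult_assoc1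
        smult_l_distr U.smult_l_distr smult_r_distr U.smult_r_distr)
qed

lemma extension_lie_algebra: "lie_algebra K extension"
proof -
  let ?E = extension
  note E = carrier_extension extension_ops
  have "x \<otimes>\<^bsub>?E\<^esub> y \<in> carrier ?E" if "x \<in> carrier ?E" "y \<in> carrier ?E" for x y
    using that by (auto simp: E bracket_closed cocycle_closed)
  moreover have "(x \<oplus>\<^bsub>?E\<^esub> y) \<otimes>\<^bsub>?E\<^esub> z = x \<otimes>\<^bsub>?E\<^esub> z \<oplus>\<^bsub>?E\<^esub> y \<otimes>\<^bsub>?E\<^esub> z"
    if "x \<in> carrier ?E" "y \<in> carrier ?E" "z \<in> carrier ?E" for x y z
    using that by (auto simp: E bracket_add_left cocycle_add_left)
  moreover have "x \<otimes>\<^bsub>?E\<^esub> (y \<oplus>\<^bsub>?E\<^esub> z) = x \<otimes>\<^bsub>?E\<^esub> y \<oplus>\<^bsub>?E\<^esub> x \<otimes>\<^bsub>?E\<^esub> z"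
    if "x \<in> carrier ?E" "y \<in> carrier ?E" "z \<in> carrier ?E" for x y z
    using that by (auto simp: E bracket_add_right cocycle_add_right)
  moreover have "(a \<odot>\<^bsub>?E\<^esub> x) \<otimes>\<^bsub>?E\<^esub> y = a \<odot>\<^bsub>?E\<^esub> (x \<otimes>\<^bsub>?E\<^esub> y)"
    if "a \<in> carrier K" "x \<in> carrier ?E" "y \<in> carrier ?E" for a x y
    using that by (auto simp: E bracket_smult_left cocycle_smult_left)
  moreover have "x \<otimes>\<^bsub>?E\<^esub> (a \<odot>\<^bsub>?E\<^esub> y) = a \<odot>\<^bsub>?E\<^esub> (x \<otimes>\<^bsub>?E\<^esub> y)"
    if "a \<in> carrier K" "x \<in> carrier ?E" "y \<in> carrier ?E" for a x y
    using that by (auto simp: E bracket_smult_right cocycle_smult_right)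
  moreover have "x \<otimes>\<^bsub>?E\<^esub> x = \<zero>\<^bsub>?E\<^esub>" if "x \<in> carrier ?E" for x
    using that by (auto simp: E bracket_self cocycle_self)
  moreover have "x \<otimes>\<^bsub>?E\<^esub> (y \<otimes>\<^bsub>?E\<^esub> z) \<oplus>\<^bsub>?E\<^esub> y \<otimes>\<^bsub>?E\<^esub> (z \<otimes>\<^bsub>?E\<^esub> x) \<oplus>\<^bsub>?E\<^esub> z \<otimes>\<^bsub>?E\<^esub> (x \<otimes>\<^bsub>?E\<^esub> y)
      = \<zero>\<^bsub>?E\<^esub>"
    if "x \<in> carrier ?E" "y \<in> carrier ?E" "z \<in> carrier ?E" for x y z
    using that by (auto simp: E jacobi cocycle_jacobi)
  ultimately show ?thesis
    by (intro lie_algebra.intro lie_algebra_axioms.intro extension_vectorspace)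
qed

text \<open>
  The bracket with \<open>z # u\<close> vanishes identically iff \<open>z\<close> is central in \<open>L\<close> and \<open>b z\<close> is zero.
\<close>

lemma center_extension:
  assumes faithful: "\<And>z. z \<in> Z \<Longrightarrow> \<forall>x\<in>carrier L. b z x = \<zero>\<^bsub>U\<^esub> \<Longrightarrow> z = \<zero>\<^bsub>L\<^esub>"
  shows "lie_center extension = {\<zero>\<^bsub>L\<^esub> # u | u. u \<in> carrier U}"
proof (intro equalityI subsetI)
  interpret U: vectorspace K U by (rule list_power_vectorspace)
  fix xs assume xs: "xs \<in> lie_center extension"
  then obtain z u where zu: "xs = z # u" "z \<in> carrier L" "u \<in> carrier U"
    by (auto simp: lie_center_def carrier_extension)
  have "z \<otimes>\<^bsub>L\<^esub> x = \<zero>\<^bsub>L\<^esub> \<and> b z x = \<zero>\<^bsub>U\<^esub>" if "x \<in> carrier L" for x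
  proof -
    have "x # \<zero>\<^bsub>U\<^esub> \<in> carrier extension" using that by (simp add: carrier_extension)
    then have "(z # u) \<otimes>\<^bsub>extension\<^esub> (x # \<zero>\<^bsub>U\<^esub>) = \<zero>\<^bsub>extension\<^esub>"
      using xs zu by (simp add: lie_center_def)
    then show ?thesis by (simp add: extension_ops)
  qed
  then have "z \<in> Z" "\<forall>x\<in>carrier L. b z x = \<zero>\<^bsub>U\<^esub>"
    using zu by (simp_all add: lie_center_def)
  then have "z = \<zero>\<^bsub>L\<^esub>" by (rule faithful)
  then show "xs \<in> {\<zero>\<^bsub>L\<^esub> # u | u. u \<in> carrier U}" using zu by simp
next
  interpret U: vectorspace K U by (rule list_power_vectorspace)
  fix xs assume "xs \<in> {\<zero>\<^bsub>L\<^esub> # u | u. u \<in> carrier U}"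
  moreover have "b \<zero>\<^bsub>L\<^esub> x = \<zero>\<^bsub>U\<^esub>" if "x \<in> carrier L" for x
    using that cocycle_smult_left[of "\<zero>\<^bsub>K\<^esub>" x x] cocycle_closed by simp
  ultimately show "xs \<in> lie_center extension"
    by (auto simp: lie_center_def carrier_extension extension_ops bracket_zero_left)
qed

lemma capable_if_faithful:
  assumes faithful: "\<And>z. z \<in> Z \<Longrightarrow> \<forall>x\<in>carrier L. b z x = \<zero>\<^bsub>U\<^esub> \<Longrightarrow> z = \<zero>\<^bsub>L\<^esub>"
  shows "lie_capable K L"
  unfolding lie_capable_def
proof (intro exI[of _ extension] conjI)
  show E: "lie_algebra K extension" by (rule extension_lie_algebra)
  interpret U: vectorspace K U by (rule list_power_vectorspace)
  interpret E: lie_algebra K extension by (rule E)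
  note cen = center_extension[OF faithful]
  let ?Q = "lie_quotient extension (lie_center extension)"
  let ?f = "\<lambda>x. E.coset (x # \<zero>\<^bsub>U\<^esub>)"
  have mem: "x # \<zero>\<^bsub>U\<^esub> \<in> carrier extension" if "x \<in> carrier L" for x
    using that by (simp add: carrier_extension)
  have eq: "E.coset (x # u) = E.coset (y # v) \<longleftrightarrow> x = y"
    if "x \<in> carrier L" "y \<in> carrier L" "u \<in> carrier U" "v \<in> carrier U" for x y u v
  proof -
    have "x # u \<in> carrier extension" "y # v \<in> carrier extension"
      using that by (auto simp: carrier_extension)
    moreover have "(x # u) \<ominus>\<^bsub>extension\<^esub> (y # v) = (x \<ominus>\<^bsub>L\<^esub> y) # (u \<ominus>\<^bsub>U\<^esub> v)"
      using \<open>y # v \<in> carrier extension\<close> that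
      by (simp add: a_minus_def E.smult_minus_1[symmetric] extension_ops smult_minus_1 U.smult_minus_1)
    ultimately show ?thesis
      using that by (subst E.coset_eq_iff) (simp_all add: cen)
  qed
  show "lie_isomorphic K L ?Q"
    unfolding lie_isomorphic_def
  proof (intro bexI[of _ ?f] conjI ballI)
    show "bij_betw ?f (carrier L) (carrier ?Q)"
      unfolding bij_betw_def
    proof
      show "inj_on ?f (carrier L)" by (rule inj_onI) (simp add: eq)
      have "E.coset xs \<in> ?f ` carrier L" if xs: "xs \<in> carrier extension" for xs
      proof -
        obtain x u where "xs = x # u" "x \<in> carrier L" "u \<in> carrier U"
          using xs by (auto simp: carrier_extension)
        then have "E.coset xs = ?f x" by (simp add: eq)
        then show ?thesis using \<open>x \<in> carrier L\<close> by blast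
      qed
      then show "?f ` carrier L = carrier ?Q"
        using mem by (auto simp: E.carrier_quotient)
    qed
    show "?f (x \<otimes>\<^bsub>L\<^esub> y) = ?f x \<otimes>\<^bsub>?Q\<^esub> ?f y" if "x \<in> carrier L" "y \<in> carrier L" for x y
      using that by (simp add: E.coset_bracket mem extension_ops eq bracket_closed cocycle_closed)
    show "?f \<in> module_hom K L ?Q"
      unfolding module_hom_def
      by (auto simp: E.coset_add E.coset_smult mem extension_ops E.carrier_quotient)
  qed
qed

end

section \<open>Coordinates modulo a subspace, and linear relations\<close>

context vectorspace
begin

lemma linear_form_closed: "linear_form f \<Longrightarrow> x \<in> carrier V \<Longrightarrow> f x \<in> carrier K"
  by (auto simp: linear_form_def)

lemma linear_form_add: "linear_form f \<Longrightarrow> x \<in> carrier V \<Longrightarrow> y \<in> carrier V \<Longrightarrow>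
    f (x \<oplus>\<^bsub>V\<^esub> y) = f x \<oplus>\<^bsub>K\<^esub> f y"
  by (simp add: linear_form_def)

lemma linear_form_smult: "linear_form f \<Longrightarrow> a \<in> carrier K \<Longrightarrow> x \<in> carrier V \<Longrightarrow>
    f (a \<odot>\<^bsub>V\<^esub> x) = a \<otimes>\<^bsub>K\<^esub> f x"
  by (simp add: linear_form_def)

text \<open>
  A set \<open>C\<close> of least size among those that generate \<open>V\<close> modulo \<open>Z\<close> is independent modulo \<open>Z\<close>: each of
  its members lies outside the span of \<open>Z\<close> and the other members, hence is separated from it by a
  linear form. These forms are the coordinates.
\<close>

lemma dual_basis_modulo:
  assumes Z: "submodule K Z V" and B: "finite B" "B \<subseteq> carrier V" "span (B \<union> Z) = carrier V"
  shows "\<exists>m e \<phi>. m \<le> card B \<and> (\<forall>i<m. e i \<in> carrier V \<and> linear_form (\<phi> i) \<and>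
      (\<forall>z\<in>Z. \<phi> i z = \<zero>\<^bsub>K\<^esub>) \<and> (\<forall>j<m. \<phi> i (e j) = (if i = j then \<one>\<^bsub>K\<^esub> else \<zero>\<^bsub>K\<^esub>))) \<and>
    (\<forall>x\<in>carrier V. \<exists>z\<in>Z. x = z \<oplus>\<^bsub>V\<^esub> (\<Oplus>\<^bsub>V\<^esub>i\<in>{..<m}. \<phi> i x \<odot>\<^bsub>V\<^esub> e i))"
proof -
  define gen where "gen C \<longleftrightarrow> finite C \<and> C \<subseteq> carrier V \<and> span (C \<union> Z) = carrier V" for C
  have "gen B" using B by (simp add: gen_def)
  then obtain C where C: "gen C" and least: "\<And>D. gen D \<Longrightarrow> card C \<le> card D"
    using ex_has_least_nat[of gen B card] by blast
  have fin: "finite C" and sC: "C \<subseteq> carrier V" and span_C: "span (C \<union> Z) = carrier V"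
    using C by (auto simp: gen_def)
  note sZ = submodule.subset[OF Z]
  let ?m = "card C"
  obtain e where e: "bij_betw e {..<?m} C"
    using ex_bij_betw_nat_finite[OF fin] by (auto simp: atLeast0LessThan)
  have e_mem: "e i \<in> C" if "i < ?m" for i
    using e that by (auto simp: bij_betw_def)
  have e_carrier: "e i \<in> carrier V" if "i < ?m" for i
    using e_mem[OF that] sC by blast
  have e_inj: "e i = e j \<longleftrightarrow> i = j" if "i < ?m" "j < ?m" for i j
    using e that by (auto simp: bij_betw_def inj_on_def)
  define S where "S i = span ((C - {e i}) \<union> Z)" for i
  have sub: "(C - {e i}) \<union> Z \<subseteq> carrier V" for i using sC sZ by blast
  have S: "submodule K (S i) V" for i
    unfolding S_def by (rule span_is_submodule[OF sub])
  have S_mem: "(C - {e i}) \<union> Z \<subseteq> S i" for i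
    unfolding S_def by (rule in_own_span[OF sub])
  have notin: "e i \<notin> S i" if i: "i < ?m" for i
  proof
    assume "e i \<in> S i"
    then have "C \<union> Z \<subseteq> S i" using S_mem[of i] by blast
    then have "span (C \<union> Z) \<subseteq> S i" by (rule span_is_subset[OF _ S])
    then have "S i = carrier V" using span_C submodule.subset[OF S] by blast
    then have "gen (C - {e i})" using fin sC by (auto simp: gen_def S_def)
    then have "card C \<le> card (C - {e i})" by (rule least)
    then show False using fin e_mem[OF i] by (metis card_Diff1_less not_less)
  qed
  have "\<forall>i\<in>{..<?m}. \<exists>f. linear_form f \<and> (\<forall>x\<in>S i. f x = \<zero>\<^bsub>K\<^esub>) \<and> f (e i) = \<one>\<^bsub>K\<^esub>"
    using separating_linear_form[OF S e_carrier notin] by simp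
  from bchoice[OF this] obtain \<phi> where
    \<phi>: "\<And>i. i < ?m \<Longrightarrow> linear_form (\<phi> i)" "\<And>i x. i < ?m \<Longrightarrow> x \<in> S i \<Longrightarrow> \<phi> i x = \<zero>\<^bsub>K\<^esub>"
      "\<And>i. i < ?m \<Longrightarrow> \<phi> i (e i) = \<one>\<^bsub>K\<^esub>"
    by auto
  have \<phi>_Z: "\<phi> i z = \<zero>\<^bsub>K\<^esub>" if "i < ?m" "z \<in> Z" for i z
    using that S_mem[of i] by (intro \<phi>(2)) auto
  have \<phi>_e: "\<phi> i (e j) = (if i = j then \<one>\<^bsub>K\<^esub> else \<zero>\<^bsub>K\<^esub>)" if "i < ?m" "j < ?m" for i j
  proof (cases "i = j")
    case False
    then have "e j \<in> S i" using S_mem[of i] e_mem[OF that(2)] e_inj[OF that] by auto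
    then show ?thesis using False \<phi>(2) that by simp
  qed (use \<phi>(3) that in simp)
  define s where "s x = (\<Oplus>\<^bsub>V\<^esub>i\<in>{..<?m}. \<phi> i x \<odot>\<^bsub>V\<^esub> e i)" for x
  have s_closed: "s x \<in> carrier V" if "x \<in> carrier V" for x
    unfolding s_def using that by (intro M.finsum_closed) (auto simp: linear_form_closed \<phi> e_carrier)
  have s_add: "s (x \<oplus>\<^bsub>V\<^esub> y) = s x \<oplus>\<^bsub>V\<^esub> s y" if "x \<in> carrier V" "y \<in> carrier V" for x y
  proof -
    have "s (x \<oplus>\<^bsub>V\<^esub> y) = (\<Oplus>\<^bsub>V\<^esub>i\<in>{..<?m}. \<phi> i x \<odot>\<^bsub>V\<^esub> e i \<oplus>\<^bsub>V\<^esub> \<phi> i y \<odot>\<^bsub>V\<^esub> e i)"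
      unfolding s_def using that
      by (intro M.finsum_cong') (auto simp: linear_form_add linear_form_closed \<phi>(1) e_carrier smult_l_distr)
    also have "\<dots> = s x \<oplus>\<^bsub>V\<^esub> s y"
      unfolding s_def using that
      by (intro M.finsum_addf) (auto simp: linear_form_closed \<phi>(1) e_carrier)
    finally show ?thesis .
  qed
  have s_smult: "s (a \<odot>\<^bsub>V\<^esub> x) = a \<odot>\<^bsub>V\<^esub> s x" if "a \<in> carrier K" "x \<in> carrier V" for a x
  proof -
    have "s (a \<odot>\<^bsub>V\<^esub> x) = (\<Oplus>\<^bsub>V\<^esub>i\<in>{..<?m}. a \<odot>\<^bsub>V\<^esub> (\<phi> i x \<odot>\<^bsub>V\<^esub> e i))"
      unfolding s_def using that
      by (intro M.finsum_cong') (auto simp: linear_form_smult linear_form_closed \<phi>(1) e_carrier smult_assoc1)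
    also have "\<dots> = a \<odot>\<^bsub>V\<^esub> s x"
      unfolding s_def using that
      by (intro finsum_smult[symmetric]) (auto simp: linear_form_closed \<phi>(1) e_carrier)
    finally show ?thesis .
  qed
  have s_Z: "s z = \<zero>\<^bsub>V\<^esub>" if "z \<in> Z" for z
    unfolding s_def using that by (intro M.add.finprod_one_eqI) (simp add: \<phi>_Z e_carrier)
  have s_e: "s (e j) = e j" if j: "j < ?m" for j
  proof -
    have "s (e j) = (\<Oplus>\<^bsub>V\<^esub>i\<in>{..<?m}. if j = i then e i else \<zero>\<^bsub>V\<^esub>)"
      unfolding s_def using j by (intro M.finsum_cong') (auto simp: \<phi>_e e_carrier)
    also have "\<dots> = e j"
      using j by (intro M.finsum_singleton) (auto simp: e_carrier)
    finally show ?thesis .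
  qed
  let ?X = "{x \<in> carrier V. \<exists>z\<in>Z. x = z \<oplus>\<^bsub>V\<^esub> s x}"
  have "submodule K ?X V"
  proof (rule submodule.intro)
    show "\<zero>\<^bsub>V\<^esub> \<in> ?X"
      using submodule.zero_closed[OF Z] s_Z by (auto intro!: bexI[of _ "\<zero>\<^bsub>V\<^esub>"])
    show "x \<oplus>\<^bsub>V\<^esub> y \<in> ?X" if xy: "x \<in> ?X" "y \<in> ?X" for x y
    proof -
      obtain z w where zw: "z \<in> Z" "x = z \<oplus>\<^bsub>V\<^esub> s x" "w \<in> Z" "y = w \<oplus>\<^bsub>V\<^esub> s y" using xy by blast
      have xyV: "x \<in> carrier V" "y \<in> carrier V" using xy by auto
      have "x \<oplus>\<^bsub>V\<^esub> y = (z \<oplus>\<^bsub>V\<^esub> s x) \<oplus>\<^bsub>V\<^esub> (w \<oplus>\<^bsub>V\<^esub> s y)" using zw by metis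
      also have "\<dots> = (z \<oplus>\<^bsub>V\<^esub> w) \<oplus>\<^bsub>V\<^esub> s (x \<oplus>\<^bsub>V\<^esub> y)"
        using zw(1,3) sZ xyV by (simp add: s_add s_closed M.a_ac subset_iff)
      finally show ?thesis using xyV submodule.m_closed[OF Z zw(1,3)] by blast
    qed
    show "a \<odot>\<^bsub>V\<^esub> x \<in> ?X" if ax: "a \<in> carrier K" "x \<in> ?X" for a x
    proof -
      obtain z where z: "z \<in> Z" "x = z \<oplus>\<^bsub>V\<^esub> s x" using ax by blast
      have xV: "x \<in> carrier V" using ax by simp
      have "a \<odot>\<^bsub>V\<^esub> x = a \<odot>\<^bsub>V\<^esub> (z \<oplus>\<^bsub>V\<^esub> s x)" using z by metis
      also have "\<dots> = a \<odot>\<^bsub>V\<^esub> z \<oplus>\<^bsub>V\<^esub> s (a \<odot>\<^bsub>V\<^esub> x)"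
        using z(1) sZ xV ax(1) by (simp add: s_smult s_closed smult_r_distr subset_iff)
      finally have "a \<odot>\<^bsub>V\<^esub> x = a \<odot>\<^bsub>V\<^esub> z \<oplus>\<^bsub>V\<^esub> s (a \<odot>\<^bsub>V\<^esub> x)" .
      moreover have "a \<odot>\<^bsub>V\<^esub> x \<in> carrier V" using xV ax(1) by simp
      ultimately show ?thesis using submodule.smult_closed[OF Z ax(1) z(1)] by blast
    qed
  qed (auto simp: module_axioms)
  moreover have "C \<union> Z \<subseteq> ?X"
  proof
    fix x assume "x \<in> C \<union> Z"
    then consider "x \<in> Z" | j where "j < ?m" "x = e j"
      using e by (auto simp: bij_betw_def)
    then show "x \<in> ?X"
    proof cases
      case 1
      then have "x = x \<oplus>\<^bsub>V\<^esub> s x" "x \<in> carrier V" using sZ s_Z by auto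
      then show ?thesis using 1 by blast
    next
      case 2
      then have "x = \<zero>\<^bsub>V\<^esub> \<oplus>\<^bsub>V\<^esub> s x" "x \<in> carrier V" using s_e e_carrier by auto
      then show ?thesis using submodule.zero_closed[OF Z] by blast
    qed
  qed
  ultimately have "span (C \<union> Z) \<subseteq> ?X" by (rule span_is_subset[rotated])
  then have "\<forall>x\<in>carrier V. \<exists>z\<in>Z. x = z \<oplus>\<^bsub>V\<^esub> s x" using span_C by blast
  then show ?thesis
    using least[OF \<open>gen B\<close>] \<phi>(1) \<phi>_Z \<phi>_e e_carrier unfolding s_def
    by (intro exI[of _ ?m] exI[of _ e] exI[of _ \<phi>]) simp
qed

lemma exchange_by_relation:
  assumes P: "finite P" and c: "\<And>p. p \<in> P \<Longrightarrow> c p \<in> carrier V"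
    and r: "\<And>p. p \<in> P \<Longrightarrow> r p \<in> carrier K" "(\<Oplus>\<^bsub>V\<^esub>p\<in>P. r p \<odot>\<^bsub>V\<^esub> c p) = \<zero>\<^bsub>V\<^esub>"
    and q: "q \<in> P" "r q \<noteq> \<zero>\<^bsub>K\<^esub>" and X: "\<And>p. p \<in> P - {q} \<Longrightarrow> r p \<noteq> \<zero>\<^bsub>K\<^esub> \<Longrightarrow> c p \<in> W"
    and W: "submodule K W V"
  shows "c q \<in> W"
proof -
  let ?s = "\<Oplus>\<^bsub>V\<^esub>p\<in>P - {q}. r p \<odot>\<^bsub>V\<^esub> c p"
  have sW: "?s \<in> W"
  proof (rule submodule_finsum[OF W])
    fix p assume p: "p \<in> P - {q}"
    show "r p \<odot>\<^bsub>V\<^esub> c p \<in> W"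
    proof (cases "r p = \<zero>\<^bsub>K\<^esub>")
      case True
      then show ?thesis using c p submodule.zero_closed[OF W] by simp
    next
      case False
      then show ?thesis using r(1) p X submodule.smult_closed[OF W] by simp
    qed
  qed
  have "(\<Oplus>\<^bsub>V\<^esub>p\<in>insert q (P - {q}). r p \<odot>\<^bsub>V\<^esub> c p) = r q \<odot>\<^bsub>V\<^esub> c q \<oplus>\<^bsub>V\<^esub> ?s"
    using P q c r(1) by (intro M.finsum_insert) auto
  then have "r q \<odot>\<^bsub>V\<^esub> c q \<oplus>\<^bsub>V\<^esub> ?s = \<zero>\<^bsub>V\<^esub>"
    using r(2) q by (simp add: insert_absorb)
  then have "r q \<odot>\<^bsub>V\<^esub> c q = \<ominus>\<^bsub>V\<^esub> ?s"
    using q c r(1) sW submodule.subset[OF W] by (intro M.minus_equality[symmetric]) auto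
  then have "r q \<odot>\<^bsub>V\<^esub> c q \<in> W" using submodule_neg[OF W sW] by simp
  then show ?thesis using submodule_smult_cancel[OF W r(1)[OF q(1)] q(2) c[OF q(1)]] by blast
qed

text \<open>
  Three relations in triangular position allow three of the vectors to be dropped: \<open>c p1\<close> is a
  combination of vectors that are kept, then \<open>c p2\<close> is, and then \<open>c p3\<close>.
\<close>

lemma span_without_pivots:
  assumes P: "finite P" and c: "\<And>p. p \<in> P \<Longrightarrow> c p \<in> carrier V"
    and r: "\<And>p. p \<in> P \<Longrightarrow> r1 p \<in> carrier K" "(\<Oplus>\<^bsub>V\<^esub>p\<in>P. r1 p \<odot>\<^bsub>V\<^esub> c p) = \<zero>\<^bsub>V\<^esub>"
      "\<And>p. p \<in> P \<Longrightarrow> r2 p \<in> carrier K" "(\<Oplus>\<^bsub>V\<^esub>p\<in>P. r2 p \<odot>\<^bsub>V\<^esub> c p) = \<zero>\<^bsub>V\<^esub>"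
      "\<And>p. p \<in> P \<Longrightarrow> r3 p \<in> carrier K" "(\<Oplus>\<^bsub>V\<^esub>p\<in>P. r3 p \<odot>\<^bsub>V\<^esub> c p) = \<zero>\<^bsub>V\<^esub>"
    and piv: "p1 \<in> P" "p2 \<in> P" "p3 \<in> P" "r1 p1 \<noteq> \<zero>\<^bsub>K\<^esub>" "r2 p2 \<noteq> \<zero>\<^bsub>K\<^esub>" "r3 p3 \<noteq> \<zero>\<^bsub>K\<^esub>"
    and tri: "r1 p2 = \<zero>\<^bsub>K\<^esub>" "r1 p3 = \<zero>\<^bsub>K\<^esub>" "r2 p3 = \<zero>\<^bsub>K\<^esub>"
  shows "span (c ` (P - {p1, p2, p3})) = span (c ` P)"
proof -
  let ?W = "span (c ` (P - {p1, p2, p3}))"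
  have sub: "c ` (P - {p1, p2, p3}) \<subseteq> carrier V" using c by auto
  have W: "submodule K ?W V" by (rule span_is_submodule[OF sub])
  have rest: "c p \<in> ?W" if "p \<in> P" "p \<noteq> p1" "p \<noteq> p2" "p \<noteq> p3" for p
    using in_own_span[OF sub] that by auto
  have "c p1 \<in> ?W"
    using rest tri by (intro exchange_by_relation[OF P c r(1,2) piv(1,4) _ W]) auto
  moreover from this have "c p2 \<in> ?W"
    using rest tri by (intro exchange_by_relation[OF P c r(3,4) piv(2,5) _ W]) auto
  moreover from calculation have "c p3 \<in> ?W"
    using rest by (intro exchange_by_relation[OF P c r(5,6) piv(3,6) _ W]) auto
  ultimately have "c ` P \<subseteq> ?W" using rest by blast
  then have "span (c ` P) \<subseteq> ?W" by (rule span_is_subset[OF _ W])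
  then show ?thesis using span_is_monotone[of "c ` (P - {p1, p2, p3})" "c ` P"] by blast
qed

end

section \<open>Identities for two- and three-rowed determinants\<close>

context cring
begin

text \<open>
  Both sides are the determinant of the matrix with rows \<open>(a1, a2, a3)\<close>, \<open>(b1, b2, b3)\<close>,
  \<open>(c1, c2, c3)\<close>, expanded along its first and along its second column.
\<close>

lemma det3_rotate:
  assumes "a1 \<in> carrier R" "a2 \<in> carrier R" "a3 \<in> carrier R" "b1 \<in> carrier R" "b2 \<in> carrier R"
    "b3 \<in> carrier R" "c1 \<in> carrier R" "c2 \<in> carrier R" "c3 \<in> carrier R"
  shows "a1 \<otimes> (b2 \<otimes> c3 \<ominus> b3 \<otimes> c2) \<oplus> b1 \<otimes> (c2 \<otimes> a3 \<ominus> c3 \<otimes> a2) \<oplus> c1 \<otimes> (a2 \<otimes> b3 \<ominus> a3 \<otimes> b2) =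
    a2 \<otimes> (b3 \<otimes> c1 \<ominus> b1 \<otimes> c3) \<oplus> b2 \<otimes> (c3 \<otimes> a1 \<ominus> c1 \<otimes> a3) \<oplus> c2 \<otimes> (a3 \<otimes> b1 \<ominus> a1 \<otimes> b3)"
  using assms by algebra

lemma det3_repeated:
  assumes "a1 \<in> carrier R" "a3 \<in> carrier R" "b1 \<in> carrier R"
    "b3 \<in> carrier R" "c1 \<in> carrier R" "c3 \<in> carrier R"
  shows "a1 \<otimes> (b1 \<otimes> c3 \<ominus> b3 \<otimes> c1) \<oplus> b1 \<otimes> (c1 \<otimes> a3 \<ominus> c3 \<otimes> a1) \<oplus> c1 \<otimes> (a1 \<otimes> b3 \<ominus> a3 \<otimes> b1) = \<zero>"
  using assms by algebra

lemma minor_add: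
  assumes "a \<in> carrier R" "b \<in> carrier R" "c \<in> carrier R" "d \<in> carrier R" "x \<in> carrier R" "y \<in> carrier R"
  shows "(a \<oplus> b) \<otimes> x \<ominus> (c \<oplus> d) \<otimes> y = (a \<otimes> x \<ominus> c \<otimes> y) \<oplus> (b \<otimes> x \<ominus> d \<otimes> y)"
  using assms by algebra

lemma minor_mult:
  assumes "a \<in> carrier R" "b \<in> carrier R" "c \<in> carrier R" "d \<in> carrier R" "x \<in> carrier R"
  shows "(x \<otimes> a) \<otimes> b \<ominus> (x \<otimes> c) \<otimes> d = x \<otimes> (a \<otimes> b \<ominus> c \<otimes> d)"
  using assms by algebra

lemma minor_swap:
  assumes "a \<in> carrier R" "b \<in> carrier R" "c \<in> carrier R" "d \<in> carrier R"
  shows "c \<otimes> d \<ominus> a \<otimes> b = \<ominus> (b \<otimes> a \<ominus> d \<otimes> c)"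
  using assms by algebra

end

section \<open>Brackets in coordinates\<close>

text \<open>
  A Lie algebra of nilpotency class at most two with a basis \<open>e 0, \<dots>, e (m - 1)\<close> modulo the center
  and the coordinate forms \<open>\<phi>\<close> dual to it.
\<close>

locale lie_coordinates = lie_algebra +
  fixes m :: nat and e :: "nat \<Rightarrow> 'c" and \<phi> :: "nat \<Rightarrow> 'c \<Rightarrow> 'a"
  assumes e_closed: "i < m \<Longrightarrow> e i \<in> carrier L"
    and coord_form: "i < m \<Longrightarrow> linear_form (\<phi> i)"
    and coord_center: "i < m \<Longrightarrow> z \<in> Z \<Longrightarrow> \<phi> i z = \<zero>\<^bsub>K\<^esub>"
    and coord_basis: "i < m \<Longrightarrow> j < m \<Longrightarrow> \<phi> i (e j) = (if i = j then \<one>\<^bsub>K\<^esub> else \<zero>\<^bsub>K\<^esub>)"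
    and decomposition: "x \<in> carrier L \<Longrightarrow>
      \<exists>z\<in>Z. x = z \<oplus>\<^bsub>L\<^esub> (\<Oplus>\<^bsub>L\<^esub>i\<in>{..<m}. \<phi> i x \<odot>\<^bsub>L\<^esub> e i)"
    and bracket_central: "x \<in> carrier L \<Longrightarrow> y \<in> carrier L \<Longrightarrow> x \<otimes>\<^bsub>L\<^esub> y \<in> Z"
begin

definition pairs :: "(nat \<times> nat) set" where
  "pairs = (SIGMA j:{..<m}. {..<j})"

lemma mem_pairs: "(j, k) \<in> pairs \<longleftrightarrow> k < j \<and> j < m"
  by (auto simp: pairs_def)

lemma finite_pairs: "finite pairs"
  by (simp add: pairs_def)

lemma card_pairs: "2 * card pairs = m * (m - 1)"
proof -
  have "card pairs = m * (m - 1) div 2"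
    using Sum_Ico_nat[of 0 m] by (simp add: pairs_def lessThan_atLeast0)
  moreover have "even (m * (m - 1))" by (cases m) auto
  ultimately show ?thesis by simp
qed

definition basis_bracket :: "nat \<times> nat \<Rightarrow> 'c" where
  "basis_bracket p = e (fst p) \<otimes>\<^bsub>L\<^esub> e (snd p)"

lemma basis_bracket_closed: "p \<in> pairs \<Longrightarrow> basis_bracket p \<in> carrier L"
  by (cases p) (auto simp: basis_bracket_def mem_pairs bracket_closed e_closed)

definition coeffs :: "(nat \<Rightarrow> nat \<Rightarrow> 'a) \<Rightarrow> bool" where
  "coeffs r \<longleftrightarrow> (\<forall>j<m. \<forall>k<m. r j k \<in> carrier K)"

lemma coeffsD: "coeffs r \<Longrightarrow> p \<in> pairs \<Longrightarrow> r (fst p) (snd p) \<in> carrier K"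
  by (cases p) (simp add: coeffs_def mem_pairs)

text \<open>
  The value of a coefficient matrix on the brackets of the basis. Only entries below the diagonal are
  read, since the others belong to the same brackets up to sign. A relation between the brackets is a
  matrix \<open>r\<close> with \<open>comb r = 0\<close>.
\<close>

definition comb :: "(nat \<Rightarrow> nat \<Rightarrow> 'a) \<Rightarrow> 'c" where
  "comb r = (\<Oplus>\<^bsub>L\<^esub>p\<in>pairs. r (fst p) (snd p) \<odot>\<^bsub>L\<^esub> basis_bracket p)"

lemma comb_closed: "coeffs r \<Longrightarrow> comb r \<in> carrier L"
  unfolding comb_def by (intro M.finsum_closed) (auto simp: coeffsD basis_bracket_closed)

lemma comb_cong:
  assumes "\<And>j k. k < j \<Longrightarrow> j < m \<Longrightarrow> r j k = s j k" "coeffs s"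
  shows "comb r = comb s"
  unfolding comb_def using assms
  by (intro M.finsum_cong') (auto simp: coeffsD basis_bracket_closed mem_pairs)

lemma comb_zero:
  assumes "\<And>j k. k < j \<Longrightarrow> j < m \<Longrightarrow> r j k = \<zero>\<^bsub>K\<^esub>"
  shows "comb r = \<zero>\<^bsub>L\<^esub>"
  unfolding comb_def
proof (rule M.add.finprod_one_eqI)
  fix p assume p: "p \<in> pairs"
  then have "r (fst p) (snd p) = \<zero>\<^bsub>K\<^esub>" using assms by (cases p) (simp add: mem_pairs)
  then show "r (fst p) (snd p) \<odot>\<^bsub>L\<^esub> basis_bracket p = \<zero>\<^bsub>L\<^esub>" using basis_bracket_closed[OF p] by simp
qed

lemma comb_add:
  assumes "coeffs r" "coeffs s"
  shows "comb (\<lambda>j k. r j k \<oplus>\<^bsub>K\<^esub> s j k) = comb r \<oplus>\<^bsub>L\<^esub> comb s"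
proof -
  have "comb (\<lambda>j k. r j k \<oplus>\<^bsub>K\<^esub> s j k) =
      (\<Oplus>\<^bsub>L\<^esub>p\<in>pairs. r (fst p) (snd p) \<odot>\<^bsub>L\<^esub> basis_bracket p \<oplus>\<^bsub>L\<^esub> s (fst p) (snd p) \<odot>\<^bsub>L\<^esub> basis_bracket p)"
    unfolding comb_def using assms
    by (intro M.finsum_cong') (auto simp: coeffsD basis_bracket_closed smult_l_distr)
  also have "\<dots> = comb r \<oplus>\<^bsub>L\<^esub> comb s"
    unfolding comb_def using assms by (intro M.finsum_addf) (auto simp: coeffsD basis_bracket_closed)
  finally show ?thesis .
qed

lemma comb_smult:
  assumes "a \<in> carrier K" "coeffs r"
  shows "comb (\<lambda>j k. a \<otimes>\<^bsub>K\<^esub> r j k) = a \<odot>\<^bsub>L\<^esub> comb r"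
proof -
  have "comb (\<lambda>j k. a \<otimes>\<^bsub>K\<^esub> r j k) = (\<Oplus>\<^bsub>L\<^esub>p\<in>pairs. a \<odot>\<^bsub>L\<^esub> (r (fst p) (snd p) \<odot>\<^bsub>L\<^esub> basis_bracket p))"
    unfolding comb_def using assms
    by (intro M.finsum_cong') (auto simp: coeffsD basis_bracket_closed smult_assoc1)
  also have "\<dots> = a \<odot>\<^bsub>L\<^esub> comb r"
    unfolding comb_def using assms by (intro finsum_smult[symmetric]) (auto simp: coeffsD basis_bracket_closed)
  finally show ?thesis .
qed

lemma coord_closed: "i < m \<Longrightarrow> x \<in> carrier L \<Longrightarrow> \<phi> i x \<in> carrier K"
  by (simp add: linear_form_closed coord_form)

definition minor :: "'c \<Rightarrow> 'c \<Rightarrow> nat \<Rightarrow> nat \<Rightarrow> 'a" where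
  "minor x y j k = \<phi> j x \<otimes>\<^bsub>K\<^esub> \<phi> k y \<ominus>\<^bsub>K\<^esub> \<phi> k x \<otimes>\<^bsub>K\<^esub> \<phi> j y"

lemma coeffs_minor: "x \<in> carrier L \<Longrightarrow> y \<in> carrier L \<Longrightarrow> coeffs (minor x y)"
  by (simp add: coeffs_def minor_def coord_closed)

lemma minor_antisym:
  assumes "x \<in> carrier L" "y \<in> carrier L" "j < m" "k < m"
  shows "minor y x j k = \<ominus>\<^bsub>K\<^esub> minor x y j k" "minor x y k j = \<ominus>\<^bsub>K\<^esub> minor x y j k"
  using assms R.minor_swap[of "\<phi> k y" "\<phi> j x" "\<phi> j y" "\<phi> k x"]
    R.minor_swap[of "\<phi> j x" "\<phi> k y" "\<phi> k x" "\<phi> j y"]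
  by (simp_all add: minor_def coord_closed R.m_comm)

lemma generated_by_e:
  assumes N: "submodule K N L" and "Z \<subseteq> N" and "\<And>i. i < m \<Longrightarrow> e i \<in> N" and x: "x \<in> carrier L"
  shows "x \<in> N"
proof -
  obtain z where z: "z \<in> Z" "x = z \<oplus>\<^bsub>L\<^esub> (\<Oplus>\<^bsub>L\<^esub>i\<in>{..<m}. \<phi> i x \<odot>\<^bsub>L\<^esub> e i)"
    using decomposition[OF x] by blast
  have "(\<Oplus>\<^bsub>L\<^esub>i\<in>{..<m}. \<phi> i x \<odot>\<^bsub>L\<^esub> e i) \<in> N"
    using assms by (intro submodule_finsum[OF N] submodule.smult_closed[OF N]) (auto simp: coord_closed)
  then show ?thesis using z assms(2) submodule.m_closed[OF N] by (metis subsetD)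
qed

lemma comb_minor_hom:
  assumes y: "y \<in> carrier L"
  shows "(\<lambda>x. comb (minor x y)) \<in> module_hom K L L"
  unfolding module_hom_def
proof (intro CollectI conjI allI impI)
  show "(\<lambda>x. comb (minor x y)) \<in> carrier L \<rightarrow> carrier L"
    using y by (auto intro: comb_closed coeffs_minor)
next
  fix x x' assume x: "x \<in> carrier L \<and> x' \<in> carrier L"
  have "comb (minor (x \<oplus>\<^bsub>L\<^esub> x') y) = comb (\<lambda>j k. minor x y j k \<oplus>\<^bsub>K\<^esub> minor x' y j k)"
  proof (rule comb_cong)
    show "coeffs (\<lambda>j k. minor x y j k \<oplus>\<^bsub>K\<^esub> minor x' y j k)"
      using x y coeffs_minor by (simp add: coeffs_def)
    show "minor (x \<oplus>\<^bsub>L\<^esub> x') y j k = minor x y j k \<oplus>\<^bsub>K\<^esub> minor x' y j k" if "k < j" "j < m" for j k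
      using that x y unfolding minor_def
      by (simp add: linear_form_add coord_form coord_closed R.minor_add)
  qed
  also have "\<dots> = comb (minor x y) \<oplus>\<^bsub>L\<^esub> comb (minor x' y)"
    using x y by (simp add: comb_add coeffs_minor)
  finally show "comb (minor (x \<oplus>\<^bsub>L\<^esub> x') y) = comb (minor x y) \<oplus>\<^bsub>L\<^esub> comb (minor x' y)" .
next
  fix a x assume ax: "a \<in> carrier K \<and> x \<in> carrier L"
  have "comb (minor (a \<odot>\<^bsub>L\<^esub> x) y) = comb (\<lambda>j k. a \<otimes>\<^bsub>K\<^esub> minor x y j k)"
  proof (rule comb_cong)
    show "coeffs (\<lambda>j k. a \<otimes>\<^bsub>K\<^esub> minor x y j k)"
      using ax y coeffs_minor by (simp add: coeffs_def)
    show "minor (a \<odot>\<^bsub>L\<^esub> x) y j k = a \<otimes>\<^bsub>K\<^esub> minor x y j k" if "k < j" "j < m" for j k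
      using that ax y unfolding minor_def
      by (simp add: linear_form_smult coord_form coord_closed R.minor_mult)
  qed
  also have "\<dots> = a \<odot>\<^bsub>L\<^esub> comb (minor x y)"
    using ax y by (simp add: comb_smult coeffs_minor)
  finally show "comb (minor (a \<odot>\<^bsub>L\<^esub> x) y) = a \<odot>\<^bsub>L\<^esub> comb (minor x y)" .
qed

lemma comb_minor_swap:
  assumes "x \<in> carrier L" "y \<in> carrier L"
  shows "comb (minor y x) = \<ominus>\<^bsub>L\<^esub> comb (minor x y)"
proof -
  have "comb (minor y x) = comb (\<lambda>j k. (\<ominus>\<^bsub>K\<^esub> \<one>\<^bsub>K\<^esub>) \<otimes>\<^bsub>K\<^esub> minor x y j k)"
  proof (rule comb_cong)
    show "coeffs (\<lambda>j k. (\<ominus>\<^bsub>K\<^esub> \<one>\<^bsub>K\<^esub>) \<otimes>\<^bsub>K\<^esub> minor x y j k)"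
      using assms coeffs_minor by (simp add: coeffs_def)
    show "minor y x j k = (\<ominus>\<^bsub>K\<^esub> \<one>\<^bsub>K\<^esub>) \<otimes>\<^bsub>K\<^esub> minor x y j k" if "k < j" "j < m" for j k
      using that assms coeffs_minor[OF assms]
      by (simp add: minor_antisym(1)[of x y] R.l_minus coeffs_def)
  qed
  also have "\<dots> = \<ominus>\<^bsub>L\<^esub> comb (minor x y)"
    using assms by (simp add: comb_smult coeffs_minor smult_minus_1 comb_closed)
  finally show ?thesis .
qed

lemma bracket_hom:
  assumes "y \<in> carrier L"
  shows "(\<lambda>x. x \<otimes>\<^bsub>L\<^esub> y) \<in> module_hom K L L"
  using assms by (auto simp: module_hom_def bracket_closed bracket_add_left bracket_smult_left)

lemma comb_minor_center:
  assumes "z \<in> Z" "y \<in> carrier L"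
  shows "comb (minor z y) = \<zero>\<^bsub>L\<^esub>"
  using assms by (intro comb_zero) (simp add: minor_def coord_center coord_closed)

lemma bracket_e:
  assumes "i < m" "l < m"
  shows "e i \<otimes>\<^bsub>L\<^esub> e l = comb (minor (e i) (e l))"
proof -
  have less: "e i \<otimes>\<^bsub>L\<^esub> e l = comb (minor (e i) (e l))" if "l < i" "i < m" for i l
  proof -
    have "minor (e i) (e l) (fst p) (snd p) = (if (i, l) = p then \<one>\<^bsub>K\<^esub> else \<zero>\<^bsub>K\<^esub>)"
      if "p \<in> pairs" for p
      using that \<open>l < i\<close> \<open>i < m\<close>
      by (cases p) (auto simp: mem_pairs minor_def coord_basis a_minus_def)
    then have "comb (minor (e i) (e l)) = (\<Oplus>\<^bsub>L\<^esub>p\<in>pairs. if (i, l) = p then basis_bracket p else \<zero>\<^bsub>L\<^esub>)"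
      unfolding comb_def by (intro M.finsum_cong') (auto simp: basis_bracket_closed)
    also have "\<dots> = basis_bracket (i, l)"
      using that finite_pairs by (intro M.finsum_singleton) (auto simp: mem_pairs basis_bracket_closed)
    finally show ?thesis by (simp add: basis_bracket_def)
  qed
  consider "l < i" | "i = l" | "i < l" by linarith
  then show ?thesis
  proof cases
    case 1
    then show ?thesis using less assms by simp
  next
    case 2
    then have "comb (minor (e i) (e l)) = \<zero>\<^bsub>L\<^esub>"
      using assms by (intro comb_zero) (simp add: minor_def coord_basis)
    then show ?thesis using 2 assms by (simp add: bracket_self e_closed)
  next
    case 3
    then have "e l \<otimes>\<^bsub>L\<^esub> e i = comb (minor (e l) (e i))" using less assms by simp
    then show ?thesis
      using assms bracket_antisym[of "e i" "e l"] comb_minor_swap[of "e l" "e i"]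
      by (simp add: e_closed)
  qed
qed

text \<open>
  Both sides are linear in each argument, vanish on the center and agree on the basis.
\<close>

lemma bracket_expansion:
  assumes x: "x \<in> carrier L" and y: "y \<in> carrier L"
  shows "x \<otimes>\<^bsub>L\<^esub> y = comb (minor x y)"
proof -
  have left: "x \<otimes>\<^bsub>L\<^esub> y = comb (minor x y)"
    if x: "x \<in> carrier L" and y: "y \<in> carrier L"
      and e: "\<And>i. i < m \<Longrightarrow> e i \<otimes>\<^bsub>L\<^esub> y = comb (minor (e i) y)" for x y
  proof -
    have "submodule K {x \<in> carrier L. x \<otimes>\<^bsub>L\<^esub> y = comb (minor x y)} L"
      by (rule equalizer_submodule[OF bracket_hom[OF y] comb_minor_hom[OF y]])
    then have "x \<in> {x \<in> carrier L. x \<otimes>\<^bsub>L\<^esub> y = comb (minor x y)}"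
      by (rule generated_by_e) (auto simp: e e_closed x y center_left center_carrier comb_minor_center)
    then show ?thesis by simp
  qed
  have "e i \<otimes>\<^bsub>L\<^esub> y = comb (minor (e i) y)" if i: "i < m" for i
  proof -
    have "y \<otimes>\<^bsub>L\<^esub> e i = comb (minor y (e i))"
      using left[OF y e_closed[OF i]] bracket_e i by simp
    then show ?thesis
      using bracket_antisym[of "e i" y] comb_minor_swap[of y "e i"] i y by (simp add: e_closed)
  qed
  then show ?thesis using left[OF x y] by simp
qed

lemma derived_eq_span: "lie_derived K L = span (basis_bracket ` pairs)"
proof -
  let ?B = "{x \<otimes>\<^bsub>L\<^esub> y | x y. x \<in> carrier L \<and> y \<in> carrier L}"
  have sub: "basis_bracket ` pairs \<subseteq> carrier L" using basis_bracket_closed by blast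
  have W: "submodule K (span (basis_bracket ` pairs)) L" by (rule span_is_submodule[OF sub])
  have "?B \<subseteq> span (basis_bracket ` pairs)"
  proof clarify
    fix x y assume xy: "x \<in> carrier L" "y \<in> carrier L"
    show "x \<otimes>\<^bsub>L\<^esub> y \<in> span (basis_bracket ` pairs)"
      unfolding bracket_expansion[OF xy] comb_def
      using coeffs_minor[OF xy] in_own_span[OF sub]
      by (intro submodule_finsum[OF W] submodule.smult_closed[OF W]) (auto simp: coeffsD)
  qed
  then have "span ?B \<subseteq> span (basis_bracket ` pairs)" by (rule span_is_subset[OF _ W])
  moreover have "basis_bracket ` pairs \<subseteq> ?B"
    by (auto simp: basis_bracket_def mem_pairs) (metis e_closed less_trans)
  then have "span (basis_bracket ` pairs) \<subseteq> span ?B" by (rule span_is_monotone)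
  ultimately show ?thesis by (simp add: lie_derived_def lie_bracket_set_def)
qed

text \<open>
  The link between \<open>dim L\<^sup>2\<close> and relations: the brackets that remain after dropping redundant ones
  still generate \<open>L\<^sup>2\<close>.
\<close>

lemma derived_dim_le:
  assumes X: "X \<subseteq> pairs" "span (basis_bracket ` X) = span (basis_bracket ` pairs)"
  shows "vectorspace.dim K (L\<lparr>carrier := lie_derived K L\<rparr>) \<le> card X"
proof -
  let ?D = "lie_derived K L"
  have sub: "basis_bracket ` X \<subseteq> carrier L" using basis_bracket_closed X by blast
  have D: "?D = span (basis_bracket ` X)" using derived_eq_span X by simp
  have subm: "submodule K ?D L" unfolding D by (rule span_is_submodule[OF sub])
  interpret D: vectorspace K "L\<lparr>carrier := ?D\<rparr>"
    by (rule subspace_is_vs) (simp add: subspace_def subm vectorspace_axioms)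
  have cX: "basis_bracket ` X \<subseteq> ?D" unfolding D by (rule in_own_span[OF sub])
  have fin: "finite X" using X finite_pairs finite_subset by blast
  have "D.dim \<le> card (basis_bracket ` X)"
  proof (rule D.gen_ge_dim)
    show "D.span (basis_bracket ` X) = carrier (L\<lparr>carrier := ?D\<rparr>)"
      using span_li_not_depend(1)[OF cX subm] D by simp
  qed (use fin cX in auto)
  also have "\<dots> \<le> card X" by (rule card_image_le[OF fin])
  finally show ?thesis .
qed

section \<open>Alternating tensors and the projected wedge cocycle\<close>

abbreviation "U \<equiv> list_power L m"

text \<open>
  Invariance under rotation and a sign under one transposition give the sign under all permutations.
  The last clause does not follow from the others in characteristic two.
\<close>

definition alternating :: "(nat \<Rightarrow> nat \<Rightarrow> nat \<Rightarrow> 'a) \<Rightarrow> bool" where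
  "alternating T \<longleftrightarrow> (\<forall>i<m. \<forall>j<m. \<forall>k<m. T i j k \<in> carrier K \<and> T i j k = T j k i \<and>
     T i k j = \<ominus>\<^bsub>K\<^esub> T i j k \<and> T i i k = \<zero>\<^bsub>K\<^esub>)"

lemma alternatingD:
  assumes "alternating T" "i < m" "j < m" "k < m"
  shows "T i j k \<in> carrier K" "T j k i = T i j k" "T i k j = \<ominus>\<^bsub>K\<^esub> T i j k" "T i i k = \<zero>\<^bsub>K\<^esub>"
proof -
  have *: "T i j k \<in> carrier K \<and> T i j k = T j k i \<and> T i k j = \<ominus>\<^bsub>K\<^esub> T i j k \<and> T i i k = \<zero>\<^bsub>K\<^esub>"
    using assms unfolding alternating_def by blast
  then show "T i j k \<in> carrier K" "T i k j = \<ominus>\<^bsub>K\<^esub> T i j k" "T i i k = \<zero>\<^bsub>K\<^esub>" by blast+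
  show "T j k i = T i j k" using * by simp
qed

lemma alternating_coeffs: "alternating T \<Longrightarrow> i < m \<Longrightarrow> coeffs (T i)"
  by (simp add: coeffs_def alternatingD(1))

text \<open>
  The image in \<open>L/Z \<otimes> L\<^sup>2\<close> of the third exterior power of \<open>L/Z\<close>, with \<open>L/Z \<otimes> L\<close> written as \<open>L\<^sup>m\<close>.
\<close>

definition tensors :: "'c list set" where
  "tensors = {u \<in> carrier U. \<exists>T. alternating T \<and> (\<forall>i<m. u ! i = comb (T i))}"

lemma tensors_submodule: "submodule K tensors U"
proof (rule submodule.intro)
  interpret U: vectorspace K U by (rule list_power_vectorspace)
  show "module K U" by (rule U.module_axioms)
  show "tensors \<subseteq> carrier U" by (auto simp: tensors_def)
  show "u \<oplus>\<^bsub>U\<^esub> v \<in> tensors" if uv: "u \<in> tensors" "v \<in> tensors" for u v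
  proof -
    obtain T S where T: "alternating T" "\<And>i. i < m \<Longrightarrow> u ! i = comb (T i)"
      and S: "alternating S" "\<And>i. i < m \<Longrightarrow> v ! i = comb (S i)"
      and carr: "u \<in> carrier U" "v \<in> carrier U"
      using uv by (auto simp: tensors_def)
    have "alternating (\<lambda>i j k. T i j k \<oplus>\<^bsub>K\<^esub> S i j k)"
      unfolding alternating_def
    proof (intro allI impI)
      fix i j k assume i: "i < m" and j: "j < m" and k: "k < m"
      show "T i j k \<oplus>\<^bsub>K\<^esub> S i j k \<in> carrier K \<and>
         T i j k \<oplus>\<^bsub>K\<^esub> S i j k = T j k i \<oplus>\<^bsub>K\<^esub> S j k i \<and>
         T i k j \<oplus>\<^bsub>K\<^esub> S i k j = \<ominus>\<^bsub>K\<^esub> (T i j k \<oplus>\<^bsub>K\<^esub> S i j k) \<and>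
         T i i k \<oplus>\<^bsub>K\<^esub> S i i k = \<zero>\<^bsub>K\<^esub>"
        using alternatingD[OF T(1) i j k] alternatingD[OF S(1) i j k] by (simp add: R.minus_add)
    qed
    moreover have "(u \<oplus>\<^bsub>U\<^esub> v) ! i = comb (\<lambda>j k. T i j k \<oplus>\<^bsub>K\<^esub> S i j k)" if "i < m" for i
      using that T S carr by (simp add: list_power_nth_add comb_add alternating_coeffs)
    ultimately show ?thesis using carr unfolding tensors_def by blast
  qed
  show "\<zero>\<^bsub>U\<^esub> \<in> tensors"
  proof -
    have "alternating (\<lambda>i j k. \<zero>\<^bsub>K\<^esub>)" by (simp add: alternating_def)
    then show ?thesis
      unfolding tensors_def by (auto simp: list_power_nth_zero comb_zero)
  qed
  show "a \<odot>\<^bsub>U\<^esub> u \<in> tensors" if au: "a \<in> carrier K" "u \<in> tensors" for a u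
  proof -
    obtain T where T: "alternating T" "\<And>i. i < m \<Longrightarrow> u ! i = comb (T i)" and carr: "u \<in> carrier U"
      using au by (auto simp: tensors_def)
    have "alternating (\<lambda>i j k. a \<otimes>\<^bsub>K\<^esub> T i j k)"
      unfolding alternating_def
    proof (intro allI impI)
      fix i j k assume i: "i < m" and j: "j < m" and k: "k < m"
      show "a \<otimes>\<^bsub>K\<^esub> T i j k \<in> carrier K \<and> a \<otimes>\<^bsub>K\<^esub> T i j k = a \<otimes>\<^bsub>K\<^esub> T j k i \<and>
         a \<otimes>\<^bsub>K\<^esub> T i k j = \<ominus>\<^bsub>K\<^esub> (a \<otimes>\<^bsub>K\<^esub> T i j k) \<and> a \<otimes>\<^bsub>K\<^esub> T i i k = \<zero>\<^bsub>K\<^esub>"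
        using alternatingD[OF T(1) i j k] au by (simp add: R.r_minus)
    qed
    moreover have "(a \<odot>\<^bsub>U\<^esub> u) ! i = comb (\<lambda>j k. a \<otimes>\<^bsub>K\<^esub> T i j k)" if "i < m" for i
      using that T carr au by (simp add: list_power_nth_smult comb_smult alternating_coeffs)
    ultimately show ?thesis using carr au(1) unfolding tensors_def by blast
  qed
qed

text \<open>
  The exterior product of \<open>x\<close>, \<open>y\<close> and \<open>z\<close> in coordinates: the determinant of their coordinates with
  indices \<open>i, j, k\<close>, expanded along the index \<open>i\<close>.
\<close>

definition det3 :: "'c \<Rightarrow> 'c \<Rightarrow> 'c \<Rightarrow> nat \<Rightarrow> nat \<Rightarrow> nat \<Rightarrow> 'a" where
  "det3 x y z i j k = \<phi> i x \<otimes>\<^bsub>K\<^esub> minor y z j k \<oplus>\<^bsub>K\<^esub> \<phi> i y \<otimes>\<^bsub>K\<^esub> minor z x j k \<oplus>\<^bsub>K\<^esub> \<phi> i z \<otimes>\<^bsub>K\<^esub> minor x y j k"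

lemma minor_closed:
  "x \<in> carrier L \<Longrightarrow> y \<in> carrier L \<Longrightarrow> j < m \<Longrightarrow> k < m \<Longrightarrow> minor x y j k \<in> carrier K"
  by (simp add: minor_def coord_closed)

lemma alternating_det3:
  assumes x: "x \<in> carrier L" "y \<in> carrier L" "z \<in> carrier L"
  shows "alternating (det3 x y z)"
proof -
  have "det3 x y z i j k \<in> carrier K \<and> det3 x y z i j k = det3 x y z j k i \<and>
      det3 x y z i k j = \<ominus>\<^bsub>K\<^esub> det3 x y z i j k \<and> det3 x y z i i k = \<zero>\<^bsub>K\<^esub>"
    if ijk: "i < m" "j < m" "k < m" for i j k
  proof (intro conjI)
    note cl = coord_closed[OF ijk(1)] coord_closed[OF ijk(2)] coord_closed[OF ijk(3)]
    show "det3 x y z i j k \<in> carrier K"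
      using x ijk by (simp add: det3_def minor_closed coord_closed)
    show "det3 x y z i j k = det3 x y z j k i"
      unfolding det3_def minor_def by (intro R.det3_rotate cl x)
    show "det3 x y z i i k = \<zero>\<^bsub>K\<^esub>"
      unfolding det3_def minor_def by (intro R.det3_repeated cl x)
    have "minor y z k j = \<ominus>\<^bsub>K\<^esub> minor y z j k" "minor z x k j = \<ominus>\<^bsub>K\<^esub> minor z x j k"
      "minor x y k j = \<ominus>\<^bsub>K\<^esub> minor x y j k"
      by (rule minor_antisym(2)[OF x(2,3) ijk(2,3)] minor_antisym(2)[OF x(3,1) ijk(2,3)]
          minor_antisym(2)[OF x(1,2) ijk(2,3)])+
    then show "det3 x y z i k j = \<ominus>\<^bsub>K\<^esub> det3 x y z i j k"
      using x ijk unfolding det3_def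
      by (simp add: minor_closed coord_closed R.r_minus R.minus_add)
  qed
  then show ?thesis unfolding alternating_def by blast
qed

lemma comb_det3:
  assumes x: "x \<in> carrier L" "y \<in> carrier L" "z \<in> carrier L" and i: "i < m"
  shows "comb (det3 x y z i) = \<phi> i x \<odot>\<^bsub>L\<^esub> (y \<otimes>\<^bsub>L\<^esub> z) \<oplus>\<^bsub>L\<^esub> \<phi> i y \<odot>\<^bsub>L\<^esub> (z \<otimes>\<^bsub>L\<^esub> x) \<oplus>\<^bsub>L\<^esub> \<phi> i z \<odot>\<^bsub>L\<^esub> (x \<otimes>\<^bsub>L\<^esub> y)"
proof -
  \<comment> \<open>Well-formedness of the three summands of a slice, needed for the linearity of \<open>comb\<close>.\<close>
  have cf: "coeffs (\<lambda>j k. a \<otimes>\<^bsub>K\<^esub> minor u v j k)" if "a \<in> carrier K" "u \<in> carrier L" "v \<in> carrier L" for a u v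
    using that by (simp add: coeffs_def minor_closed)
  have cf2: "coeffs (\<lambda>j k. \<phi> i x \<otimes>\<^bsub>K\<^esub> minor y z j k \<oplus>\<^bsub>K\<^esub> \<phi> i y \<otimes>\<^bsub>K\<^esub> minor z x j k)"
    using x i by (simp add: coeffs_def minor_closed coord_closed)
  show ?thesis
    unfolding det3_def
    using x i cf cf2 by (simp add: comb_add comb_smult bracket_expansion coeffs_minor coord_closed)
qed

text \<open>
  The element \<open>x \<otimes> y - y \<otimes> x\<close> of \<open>L/Z \<otimes> L\<close>.
\<close>

definition wedge :: "'c \<Rightarrow> 'c \<Rightarrow> 'c list" where
  "wedge x y = map (\<lambda>i. \<phi> i x \<odot>\<^bsub>L\<^esub> y \<ominus>\<^bsub>L\<^esub> \<phi> i y \<odot>\<^bsub>L\<^esub> x) [0..<m]"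

lemma wedge_nth: "i < m \<Longrightarrow> wedge x y ! i = \<phi> i x \<odot>\<^bsub>L\<^esub> y \<ominus>\<^bsub>L\<^esub> \<phi> i y \<odot>\<^bsub>L\<^esub> x"
  by (simp add: wedge_def)

lemma wedge_closed: "x \<in> carrier L \<Longrightarrow> y \<in> carrier L \<Longrightarrow> wedge x y \<in> carrier U"
  by (auto simp: list_power_carrier wedge_nth coord_closed) (simp add: wedge_def)

lemma wedge_add_left:
  assumes "x \<in> carrier L" "y \<in> carrier L" "z \<in> carrier L"
  shows "wedge (x \<oplus>\<^bsub>L\<^esub> y) z = wedge x z \<oplus>\<^bsub>U\<^esub> wedge y z"
proof -
  interpret U: vectorspace K U by (rule list_power_vectorspace)
  show ?thesis
    using assms
    by (intro list_power_eqI[where V = L and n = m])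
      (auto simp: wedge_closed wedge_nth list_power_nth_add linear_form_add coord_form coord_closed
        smult_l_distr smult_r_distr a_minus_def M.minus_add M.a_ac)
qed

lemma wedge_smult_left:
  assumes "a \<in> carrier K" "x \<in> carrier L" "y \<in> carrier L"
  shows "wedge (a \<odot>\<^bsub>L\<^esub> x) y = a \<odot>\<^bsub>U\<^esub> wedge x y"
proof -
  interpret U: vectorspace K U by (rule list_power_vectorspace)
  have "\<phi> i y \<odot>\<^bsub>L\<^esub> (a \<odot>\<^bsub>L\<^esub> x) = a \<odot>\<^bsub>L\<^esub> (\<phi> i y \<odot>\<^bsub>L\<^esub> x)" if "i < m" for i
    using assms that by (simp add: smult_assoc1[symmetric] coord_closed R.m_comm)
  then show ?thesis
    using assms
    by (intro list_power_eqI[where V = L and n = m])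
      (auto simp: wedge_closed wedge_nth list_power_nth_smult linear_form_smult coord_form coord_closed
        smult_assoc1 smult_r_distr a_minus_def smult_r_minus)
qed

lemma wedge_swap:
  assumes "x \<in> carrier L" "y \<in> carrier L"
  shows "wedge x y = (\<ominus>\<^bsub>K\<^esub> \<one>\<^bsub>K\<^esub>) \<odot>\<^bsub>U\<^esub> wedge y x"
proof -
  interpret U: vectorspace K U by (rule list_power_vectorspace)
  show ?thesis
    using assms
    by (intro list_power_eqI[where V = L and n = m])
      (auto simp: wedge_closed wedge_nth list_power_nth_smult coord_closed smult_minus_1
        a_minus_def M.minus_add M.a_ac)
qed

lemma wedge_self:
  assumes "x \<in> carrier L"
  shows "wedge x x = \<zero>\<^bsub>U\<^esub>"
proof -
  interpret U: vectorspace K U by (rule list_power_vectorspace)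
  show ?thesis
    using assms
    by (intro list_power_eqI[where V = L and n = m])
      (auto simp: wedge_closed wedge_nth list_power_nth_zero coord_closed a_minus_def M.r_neg)
qed

text \<open>
  The coordinates of a bracket are zero because brackets are central. Hence the \<open>i\<close>-th entry of the
  cyclic sum is \<open>\<phi> i x [y, z] + \<phi> i y [z, x] + \<phi> i z [x, y]\<close>, which is the value of the \<open>i\<close>-th
  slice of the tensor \<open>det3 x y z\<close>.
\<close>

lemma wedge_jacobi:
  assumes x: "x \<in> carrier L" "y \<in> carrier L" "z \<in> carrier L"
  shows "wedge x (y \<otimes>\<^bsub>L\<^esub> z) \<oplus>\<^bsub>U\<^esub> wedge y (z \<otimes>\<^bsub>L\<^esub> x) \<oplus>\<^bsub>U\<^esub> wedge z (x \<otimes>\<^bsub>L\<^esub> y) \<in> tensors"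
    (is "?w \<in> _")
proof -
  interpret U: vectorspace K U by (rule list_power_vectorspace)
  have w: "?w \<in> carrier U" using x by (simp add: wedge_closed bracket_closed)
  have "?w ! i = comb (det3 x y z i)" if i: "i < m" for i
    using x i
    by (simp add: comb_det3 list_power_nth_add wedge_closed wedge_nth bracket_closed
        coord_center bracket_central coord_closed a_minus_def neg_zero)
  then show ?thesis using w alternating_det3[OF x] unfolding tensors_def by blast
qed

lemma projected_wedge_cocycle:
  assumes P: "P \<in> module_hom K U U" and ker: "\<And>u. u \<in> tensors \<Longrightarrow> P u = \<zero>\<^bsub>U\<^esub>"
  shows "lie_cocycle K L m (\<lambda>x y. P (wedge x y))"
proof -
  interpret U: vectorspace K U by (rule list_power_vectorspace)
  interpret P: mod_hom K U U P using P by unfold_locales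
  have right: "P (wedge x y) = (\<ominus>\<^bsub>K\<^esub> \<one>\<^bsub>K\<^esub>) \<odot>\<^bsub>U\<^esub> P (wedge y x)"
    if "x \<in> carrier L" "y \<in> carrier L" for x y
    using that by (subst wedge_swap) (simp_all add: wedge_closed)
  show ?thesis
  proof (unfold_locales, goal_cases)
    case (1 x y)
    then show ?case by (simp add: wedge_closed)
  next
    case (2 x y z)
    then show ?case by (simp add: wedge_add_left wedge_closed)
  next
    case (3 x y z)
    then have "P (wedge (y \<oplus>\<^bsub>L\<^esub> z) x) = P (wedge y x) \<oplus>\<^bsub>U\<^esub> P (wedge z x)"
      by (simp add: wedge_add_left wedge_closed)
    then show ?case
      using 3 right[of x "y \<oplus>\<^bsub>L\<^esub> z"] right[of x y] right[of x z]
      by (simp add: wedge_closed U.smult_r_distr)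
  next
    case (4 a x y)
    then show ?case by (simp add: wedge_smult_left wedge_closed)
  next
    case (5 a x y)
    then have "P (wedge (a \<odot>\<^bsub>L\<^esub> y) x) = a \<odot>\<^bsub>U\<^esub> P (wedge y x)"
      by (simp add: wedge_smult_left wedge_closed)
    then show ?case
      using 5 right[of x "a \<odot>\<^bsub>L\<^esub> y"] right[of x y]
      by (simp add: wedge_closed U.smult_assoc1[symmetric] R.m_comm)
  next
    case (6 x)
    then show ?case by (simp add: wedge_self)
  next
    case (7 x y z)
    then have "P (wedge x (y \<otimes>\<^bsub>L\<^esub> z)) \<oplus>\<^bsub>U\<^esub> P (wedge y (z \<otimes>\<^bsub>L\<^esub> x)) \<oplus>\<^bsub>U\<^esub> P (wedge z (x \<otimes>\<^bsub>L\<^esub> y)) =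
        P (wedge x (y \<otimes>\<^bsub>L\<^esub> z) \<oplus>\<^bsub>U\<^esub> wedge y (z \<otimes>\<^bsub>L\<^esub> x) \<oplus>\<^bsub>U\<^esub> wedge z (x \<otimes>\<^bsub>L\<^esub> y))"
      by (simp add: wedge_closed bracket_closed)
    also have "\<dots> = \<zero>\<^bsub>U\<^esub>" by (rule ker[OF wedge_jacobi[OF 7]])
    finally show ?case .
  qed
qed

section \<open>Alternating tensors in the presence of few relations\<close>

text \<open>
  At most two relations between the brackets of the basis are independent, phrased by way of generating
  subsets so that the dimension count applies directly.
\<close>

definition few_relations :: bool where
  "few_relations \<longleftrightarrow> (\<forall>X\<subseteq>pairs. span (basis_bracket ` X) = span (basis_bracket ` pairs) \<longrightarrow> card pairs \<le> card X + 2)"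

definition row_antisym :: "(nat \<Rightarrow> nat \<Rightarrow> 'a) \<Rightarrow> bool" where
  "row_antisym r \<longleftrightarrow> (\<forall>j<m. \<forall>k<m. r k j = \<ominus>\<^bsub>K\<^esub> r j k)"

definition ordered_pair :: "nat \<Rightarrow> nat \<Rightarrow> nat \<times> nat" where
  "ordered_pair j k = (max j k, min j k)"

lemma ordered_pair_mem: "j < m \<Longrightarrow> k < m \<Longrightarrow> j \<noteq> k \<Longrightarrow> ordered_pair j k \<in> pairs"
  by (auto simp: ordered_pair_def mem_pairs)

lemma neg_eq_zero: "a \<in> carrier K \<Longrightarrow> \<ominus>\<^bsub>K\<^esub> a = \<zero>\<^bsub>K\<^esub> \<longleftrightarrow> a = \<zero>\<^bsub>K\<^esub>"
  by (metis R.minus_minus R.minus_zero)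

lemma value_at_ordered_pair:
  assumes "coeffs r" "row_antisym r" "j < m" "k < m"
  shows "r (fst (ordered_pair j k)) (snd (ordered_pair j k)) = \<zero>\<^bsub>K\<^esub> \<longleftrightarrow> r j k = \<zero>\<^bsub>K\<^esub>"
proof (cases "k \<le> j")
  case True
  then show ?thesis by (simp add: ordered_pair_def max_def min_def)
next
  case False
  have "r k j = \<ominus>\<^bsub>K\<^esub> r j k"
    using assms unfolding row_antisym_def by blast
  with False have "r (fst (ordered_pair j k)) (snd (ordered_pair j k)) = \<ominus>\<^bsub>K\<^esub> r j k"
    by (simp add: ordered_pair_def max_def min_def)
  then show ?thesis using assms by (simp add: neg_eq_zero coeffs_def)
qed

lemma alternating_row: "alternating T \<Longrightarrow> i < m \<Longrightarrow> row_antisym (T i)"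
  unfolding row_antisym_def using alternatingD(3) by blast

text \<open>
  By alternation the slice \<open>T j\<close> is zero at the pair \<open>(a, j)\<close> and nonzero at \<open>(a, k)\<close>, and the slice
  \<open>T k\<close> is nonzero at \<open>(a, j)\<close>. A relation \<open>r\<close> that is zero at both pairs but not at \<open>p\<close> would complete
  them to a triangular system of three relations.
\<close>

lemma relation_vanishes:
  assumes few: few_relations and T: "alternating T" and ajk: "a < m" "j < m" "k < m"
    and nz: "T a j k \<noteq> \<zero>\<^bsub>K\<^esub>" and rel: "comb (T j) = \<zero>\<^bsub>L\<^esub>" "comb (T k) = \<zero>\<^bsub>L\<^esub>"
    and r: "coeffs r" "row_antisym r" "comb r = \<zero>\<^bsub>L\<^esub>" "r a j = \<zero>\<^bsub>K\<^esub>" "r a k = \<zero>\<^bsub>K\<^esub>"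
    and p: "p \<in> pairs"
  shows "r (fst p) (snd p) = \<zero>\<^bsub>K\<^esub>"
proof (rule ccontr)
  assume rp: "r (fst p) (snd p) \<noteq> \<zero>\<^bsub>K\<^esub>"
  note alt = alternatingD[OF T]
  have aj: "a \<noteq> j" using nz alt(4) ajk by metis
  have ak: "a \<noteq> k" using nz alt(2,4) ajk by metis
  have Tj: "T j a k \<noteq> \<zero>\<^bsub>K\<^esub>" "T j a j = \<zero>\<^bsub>K\<^esub>"
  proof -
    have "T j a k = \<ominus>\<^bsub>K\<^esub> T j k a" using alt(3) ajk by blast
    also have "T j k a = T a j k" using alt(2) ajk by blast
    finally show "T j a k \<noteq> \<zero>\<^bsub>K\<^esub>" using nz alt(1) ajk by (simp add: neg_eq_zero)
    show "T j a j = \<zero>\<^bsub>K\<^esub>" using alt(2,4) ajk by metis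
  qed
  have Tk: "T k a j \<noteq> \<zero>\<^bsub>K\<^esub>" using nz alt(2) ajk by metis
  note cf = alternating_coeffs[OF T ajk(2)] alternating_coeffs[OF T ajk(3)]
  note anti = alternating_row[OF T ajk(2)] alternating_row[OF T ajk(3)]
  let ?q = "ordered_pair a k" and ?s = "ordered_pair a j"
  have mem: "?q \<in> pairs" "?s \<in> pairs" using ajk aj ak by (auto intro: ordered_pair_mem)
  have rq: "r (fst ?q) (snd ?q) = \<zero>\<^bsub>K\<^esub>" "r (fst ?s) (snd ?s) = \<zero>\<^bsub>K\<^esub>"
    using r ajk by (simp_all add: value_at_ordered_pair)
  have Tq: "T j (fst ?q) (snd ?q) \<noteq> \<zero>\<^bsub>K\<^esub>" "T j (fst ?s) (snd ?s) = \<zero>\<^bsub>K\<^esub>"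
    "T k (fst ?s) (snd ?s) \<noteq> \<zero>\<^bsub>K\<^esub>"
    using Tj Tk cf anti ajk by (simp_all add: value_at_ordered_pair)
  have "span (basis_bracket ` (pairs - {p, ?q, ?s})) = span (basis_bracket ` pairs)"
    using coeffsD[OF r(1)] coeffsD[OF cf(1)] coeffsD[OF cf(2)] r(3) rel
    by (intro span_without_pivots[where ?r1.0 = "\<lambda>p. r (fst p) (snd p)" and
          ?r2.0 = "\<lambda>p. T j (fst p) (snd p)" and ?r3.0 = "\<lambda>p. T k (fst p) (snd p)"]
        finite_pairs basis_bracket_closed p mem rp rq Tq) (simp_all add: comb_def)
  then have "card pairs \<le> card (pairs - {p, ?q, ?s}) + 2"
    using few by (auto simp: few_relations_def)
  moreover have "p \<noteq> ?q" "p \<noteq> ?s" "?q \<noteq> ?s" using rp rq Tq by auto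
  then have "card {p, ?q, ?s} = 3" by simp
  moreover have "{p, ?q, ?s} \<subseteq> pairs" using p mem by simp
  moreover from this have "card (pairs - {p, ?q, ?s}) = card pairs - card {p, ?q, ?s}"
    using finite_pairs by (intro card_Diff_subset) (auto intro: finite_subset)
  moreover have "card {p, ?q, ?s} \<le> card pairs"
    using \<open>{p, ?q, ?s} \<subseteq> pairs\<close> by (rule card_mono[OF finite_pairs])
  ultimately show False by linarith
qed

lemma row_vanishes:
  assumes "coeffs r" "row_antisym r" "\<And>l. l < m \<Longrightarrow> r l l = \<zero>\<^bsub>K\<^esub>"
    and zero: "\<And>p. p \<in> pairs \<Longrightarrow> r (fst p) (snd p) = \<zero>\<^bsub>K\<^esub>" and "l < m" "s < m"
  shows "r l s = \<zero>\<^bsub>K\<^esub>"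
proof (cases "l = s")
  case False
  then show ?thesis
    using zero[OF ordered_pair_mem[of l s]] value_at_ordered_pair[OF assms(1,2), of l s] assms by simp
qed (use assms in simp)

text \<open>
  A tensor as in \<open>ex\<close> has a nonzero value only in its slice \<open>a\<close>; all its other slices are relations.
  The tensor \<open>T\<close> for \<open>a = 0\<close> supplies two relations, \<open>T j\<close> and \<open>T k\<close>, that force the tensor \<open>S\<close> for
  \<open>a = j\<close> to vanish, slice by slice.
\<close>

lemma no_concentrated_tensors:
  assumes few: few_relations and "0 < m" and w: "w \<noteq> \<zero>\<^bsub>L\<^esub>"
    and ex: "\<And>a. a < m \<Longrightarrow> \<exists>T. alternating T \<and> (\<forall>i<m. comb (T i) = (if i = a then w else \<zero>\<^bsub>L\<^esub>))"
  shows False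
proof -
  from ex[OF \<open>0 < m\<close>] obtain T where T: "alternating T"
    and "\<forall>i<m. comb (T i) = (if i = 0 then w else \<zero>\<^bsub>L\<^esub>)" by (elim exE conjE)
  then have combT: "comb (T i) = (if i = 0 then w else \<zero>\<^bsub>L\<^esub>)" if "i < m" for i
    using that by simp
  have "\<exists>j k. k < j \<and> j < m \<and> T 0 j k \<noteq> \<zero>\<^bsub>K\<^esub>"
  proof (rule ccontr)
    assume "\<not> ?thesis"
    then have "comb (T 0) = \<zero>\<^bsub>L\<^esub>" by (intro comb_zero) blast
    then show False using combT[OF \<open>0 < m\<close>] w by simp
  qed
  then obtain j k where "k < j" and jk: "j < m" "T 0 j k \<noteq> \<zero>\<^bsub>K\<^esub>" by blast
  then have k: "k < m" by simp
  note altT = alternatingD[OF T]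
  have "0 \<noteq> j" using \<open>k < j\<close> by simp
  have "0 \<noteq> k"
  proof
    assume "0 = k"
    then have "T 0 j k = T 0 0 j" using altT(2)[of 0 0 j] \<open>0 < m\<close> jk(1) by simp
    also have "\<dots> = \<zero>\<^bsub>K\<^esub>" using altT(4)[of 0 0 j] \<open>0 < m\<close> jk(1) by simp
    finally show False using jk(2) by simp
  qed
  have relT: "comb (T j) = \<zero>\<^bsub>L\<^esub>" "comb (T k) = \<zero>\<^bsub>L\<^esub>"
    using combT[OF jk(1)] combT[OF k] \<open>0 \<noteq> j\<close> \<open>0 \<noteq> k\<close> by simp_all
  from ex[OF jk(1)] obtain S where S: "alternating S"
    and "\<forall>i<m. comb (S i) = (if i = j then w else \<zero>\<^bsub>L\<^esub>)" by (elim exE conjE)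
  then have combS: "comb (S i) = (if i = j then w else \<zero>\<^bsub>L\<^esub>)" if "i < m" for i
    using that by simp
  note altS = alternatingD[OF S]
  have diag: "S b l l = \<zero>\<^bsub>K\<^esub>" if "b < m" "l < m" for b l
    using altS(2)[of b l l] altS(4)[of l l b] that by simp
  have vanish: "S b l s = \<zero>\<^bsub>K\<^esub>"
    if b: "b < m" "b \<noteq> j" and "S b 0 j = \<zero>\<^bsub>K\<^esub>" "S b 0 k = \<zero>\<^bsub>K\<^esub>" and "l < m" "s < m" for b l s
  proof (rule row_vanishes)
    show row: "coeffs (S b)" "row_antisym (S b)"
      by (rule alternating_coeffs[OF S b(1)], rule alternating_row[OF S b(1)])
    have "comb (S b) = \<zero>\<^bsub>L\<^esub>" using combS[OF b(1)] b(2) by simp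
    then show "S b (fst p) (snd p) = \<zero>\<^bsub>K\<^esub>" if "p \<in> pairs" for p
      by (rule relation_vanishes[OF few T \<open>0 < m\<close> jk(1) k jk(2) relT row])
        (fact \<open>S b 0 j = \<zero>\<^bsub>K\<^esub>\<close> \<open>S b 0 k = \<zero>\<^bsub>K\<^esub>\<close> that)+
    show "S b i i = \<zero>\<^bsub>K\<^esub>" if "i < m" for i by (rule diag[OF b(1) that])
  qed fact+
  \<comment> \<open>This slice is zero at \<open>(0, j)\<close> and \<open>(0, k)\<close> because \<open>S\<close> is alternating.\<close>
  have S0: "S 0 l s = \<zero>\<^bsub>K\<^esub>" if "l < m" "s < m" for l s
  proof (rule vanish)
    show "S 0 0 j = \<zero>\<^bsub>K\<^esub>" "S 0 0 k = \<zero>\<^bsub>K\<^esub>"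
      using altS(4)[of 0 0 j] altS(4)[of 0 0 k] \<open>0 < m\<close> jk(1) k by simp_all
  qed fact+
  \<comment> \<open>Rotating the indices moves the entries at \<open>(0, j)\<close> and \<open>(0, k)\<close> into the slice \<open>S 0\<close>.\<close>
  have Sb: "S b l s = \<zero>\<^bsub>K\<^esub>" if b: "b < m" "b \<noteq> j" and "l < m" "s < m" for b l s
  proof (rule vanish)
    show "S b 0 j = \<zero>\<^bsub>K\<^esub>" using altS(2)[of b 0 j] S0[of j b] b jk(1) \<open>0 < m\<close> by simp
    show "S b 0 k = \<zero>\<^bsub>K\<^esub>" using altS(2)[of b 0 k] S0[of k b] b k \<open>0 < m\<close> by simp
  qed fact+
  have "S j l s = \<zero>\<^bsub>K\<^esub>" if "s < l" "l < m" for l s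
  proof (cases "l = j")
    case True
    then show ?thesis using altS(4)[of j j s] that by simp
  next
    case False
    then show ?thesis using altS(2)[of j l s] Sb[of l s j] that jk(1) by simp
  qed
  then have "comb (S j) = \<zero>\<^bsub>L\<^esub>" by (rule comb_zero)
  then show False using combS[OF jk(1)] w by simp
qed

lemma capable_if_few_relations:
  assumes few: few_relations and m: "0 < m"
  shows "lie_capable K L"
proof -
  interpret U: vectorspace K U by (rule list_power_vectorspace)
  from U.module_hom_with_kernel[OF tensors_submodule]
  obtain P where P: "P \<in> module_hom K U U"
    and ker_P: "\<forall>u\<in>carrier U. P u = \<zero>\<^bsub>U\<^esub> \<longleftrightarrow> u \<in> tensors" by (elim bexE)
  interpret C: lie_cocycle K L m "\<lambda>x y. P (wedge x y)"
    by (rule projected_wedge_cocycle[OF P])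
      (use ker_P submodule.subset[OF tensors_submodule] in blast)
  show ?thesis
  proof (rule C.capable_if_faithful, rule ccontr)
    fix z assume z: "z \<in> Z" and ker: "\<forall>x\<in>carrier L. P (wedge z x) = \<zero>\<^bsub>U\<^esub>" and nz: "z \<noteq> \<zero>\<^bsub>L\<^esub>"
    have zL: "z \<in> carrier L" by (rule center_carrier[OF z])
    show False
    proof (rule no_concentrated_tensors[OF few m])
      show "\<ominus>\<^bsub>L\<^esub> z \<noteq> \<zero>\<^bsub>L\<^esub>" using nz zL neg_zero M.minus_minus[OF zL] by auto
      fix a assume a: "a < m"
      have "wedge z (e a) \<in> tensors"
        using ker ker_P e_closed[OF a] zL wedge_closed[OF zL e_closed[OF a]] by blast
      then obtain T where T: "alternating T" "\<forall>i<m. wedge z (e a) ! i = comb (T i)"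
        unfolding tensors_def by blast
      have "wedge z (e a) ! i = (if i = a then \<ominus>\<^bsub>L\<^esub> z else \<zero>\<^bsub>L\<^esub>)" if "i < m" for i
        using that a z zL
        by (simp add: wedge_nth coord_center coord_basis e_closed a_minus_def)
      then have "\<forall>i<m. comb (T i) = (if i = a then \<ominus>\<^bsub>L\<^esub> z else \<zero>\<^bsub>L\<^esub>)"
        using T(2) by metis
      then show "\<exists>T. alternating T \<and> (\<forall>i<m. comb (T i) = (if i = a then \<ominus>\<^bsub>L\<^esub> z else \<zero>\<^bsub>L\<^esub>))"
        using T(1) by (intro exI[of _ T] conjI)
    qed
  qed
qed

end

section \<open>Capability\<close>

theorem corollary2p10:
  fixes K :: "('k, 'r) ring_scheme"
    and L :: "('k, 'a, 'm) module_scheme"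
    and n d :: nat
  assumes "lie_algebra K L"
    and "vectorspace.fin_dim K L" and "vectorspace.dim K L = n"
    and "lie_nilpotent_of_class K L 2"
    and "vectorspace.dim K (lie_quotient L (lie_center L)) = d"
    and "real (vectorspace.dim K (L\<lparr>carrier := lie_derived K L\<rparr>)) = 1/2 * real d * (real d - 1) - 1
       \<or> real (vectorspace.dim K (L\<lparr>carrier := lie_derived K L\<rparr>)) = 1/2 * real d * (real d - 1) - 2"
  shows "lie_capable K L"
proof -
  interpret lie_algebra K L by (rule assms(1))
  let ?D = "L\<lparr>carrier := lie_derived K L\<rparr>"
  let ?B = "{x \<otimes>\<^bsub>L\<^esub> y | x y. x \<in> carrier L \<and> y \<in> carrier L}"
  have sub_B: "?B \<subseteq> carrier L" using bracket_closed by blast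
  have D: "lie_derived K L = span ?B" by (simp add: lie_derived_def lie_bracket_set_def)
  have series: "lie_lower_central K L 1 = lie_derived K L"
    "lie_lower_central K L 2 = lie_bracket_set K L (lie_derived K L) (carrier L)"
    by (simp_all add: lie_derived_def numeral_2_eq_2)
  have triple: "lie_bracket_set K L (lie_derived K L) (carrier L) = {\<zero>\<^bsub>L\<^esub>}"
    using assms(4) series(2) by (simp add: lie_nilpotent_of_class_def)
  have "lie_lower_central K L 1 \<noteq> {\<zero>\<^bsub>L\<^esub>}"
  proof -
    have "\<forall>i<2. lie_lower_central K L i \<noteq> {\<zero>\<^bsub>L\<^esub>}"
      using assms(4) unfolding lie_nilpotent_of_class_def by (rule conjunct2)
    then have "1 < (2::nat) \<longrightarrow> lie_lower_central K L 1 \<noteq> {\<zero>\<^bsub>L\<^esub>}" by (rule spec)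
    then show ?thesis by (rule mp) simp
  qed
  then have nonzero: "lie_derived K L \<noteq> {\<zero>\<^bsub>L\<^esub>}" unfolding series(1) .
  have central: "x \<otimes>\<^bsub>L\<^esub> y \<in> Z" if xy: "x \<in> carrier L" "y \<in> carrier L" for x y
  proof -
    have "x \<otimes>\<^bsub>L\<^esub> y \<in> lie_derived K L"
      unfolding D using in_own_span[OF sub_B] xy by blast
    moreover have "{x \<otimes>\<^bsub>L\<^esub> y | x y. x \<in> lie_derived K L \<and> y \<in> carrier L} \<subseteq> {\<zero>\<^bsub>L\<^esub>}"
    proof -
      have "lie_derived K L \<subseteq> carrier L" unfolding D by (rule span_is_subset2[OF sub_B])
      then have "{x \<otimes>\<^bsub>L\<^esub> y | x y. x \<in> lie_derived K L \<and> y \<in> carrier L} \<subseteq> carrier L"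
        using bracket_closed by blast
      from in_own_span[OF this] show ?thesis using triple by (simp add: lie_bracket_set_def)
    qed
    ultimately have "(x \<otimes>\<^bsub>L\<^esub> y) \<otimes>\<^bsub>L\<^esub> w = \<zero>\<^bsub>L\<^esub>" if "w \<in> carrier L" for w using that by blast
    then show ?thesis using xy bracket_closed by (simp add: lie_center_def)
  qed
  obtain B where B: "finite B" "B \<subseteq> carrier L" "card B \<le> d" "span (B \<union> Z) = carrier L"
    using generators_mod_center[OF assms(2,5)] by blast
  obtain m e \<phi> where m: "m \<le> card B" and
    basis: "\<forall>i<m. e i \<in> carrier L \<and> linear_form (\<phi> i) \<and> (\<forall>z\<in>Z. \<phi> i z = \<zero>\<^bsub>K\<^esub>) \<and>
      (\<forall>j<m. \<phi> i (e j) = (if i = j then \<one>\<^bsub>K\<^esub> else \<zero>\<^bsub>K\<^esub>))" and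
    dec: "\<forall>x\<in>carrier L. \<exists>z\<in>Z. x = z \<oplus>\<^bsub>L\<^esub> (\<Oplus>\<^bsub>L\<^esub>i\<in>{..<m}. \<phi> i x \<odot>\<^bsub>L\<^esub> e i)"
    using dual_basis_modulo[OF center_submodule B(1,2,4)] by blast
  interpret lie_coordinates K L m e \<phi>
    by unfold_locales (use basis dec central in \<open>blast+\<close>)
  show ?thesis
  proof (rule capable_if_few_relations)
    \<comment> \<open>The case \<open>m = 0\<close> is separate because the factor \<open>m - 1\<close> is negative there.\<close>
    have "real m * (real m - 1) \<le> real d * (real d - 1)"
    proof (cases "m = 0")
      case False
      then show ?thesis using m B(3) by (intro mult_mono) auto
    next
      case True
      then show ?thesis by (cases d) auto
    qed
    moreover have "2 * real (card pairs) = real m * (real m - 1)"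
    proof (cases m)
      case (Suc k)
      then show ?thesis using arg_cong[OF card_pairs, of real] by (simp add: algebra_simps)
    qed (use card_pairs in simp)
    ultimately have dim: "real (card pairs) \<le> real (vectorspace.dim K ?D) + 2"
      using assms(6) by auto
    show few_relations
      unfolding few_relations_def
    proof (intro allI impI)
      fix X assume "X \<subseteq> pairs" "span (basis_bracket ` X) = span (basis_bracket ` pairs)"
      then have "vectorspace.dim K ?D \<le> card X" by (rule derived_dim_le)
      then show "card pairs \<le> card X + 2" using dim by linarith
    qed
    show "0 < m"
    proof (rule ccontr)
      assume "\<not> 0 < m"
      then have "Z = carrier L"
        using dec center_carrier by auto
      then have "?B \<subseteq> {\<zero>\<^bsub>L\<^esub>}" using center_left by auto
      then have "span ?B \<subseteq> {\<zero>\<^bsub>L\<^esub>}" by (rule span_is_subset[OF _ trivial_submodule])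
      then show False
        using nonzero D submodule.zero_closed[OF span_is_submodule[OF sub_B]] by blast
    qed
  qed
qed

end
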